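(* Let $a<b$, let $n_0,n_1,n_2\ge 0$ be integers, and let $B\in\mathbb{R}^{(n_1+2n_2)\times(2n_1+4n_2)}$ be such that $BT$ is invertible, with $T$, the space $X$, its form $\langle\cdot,\cdot\rangle_X$, and the functions $G_0,G_1,G_2$ as defined in the context. Let $\mathcal{T}=\mathcal{P}_{\{G_0,G_1,G_2\}}$. Then for any $\mathbf{x}\in X$, $$\mathbf{x}=\mathcal{T}\begin{bmatrix} I&&\\ &\partial_s&\\ &&\partial_s^2\end{bmatrix}\mathbf{x}.$$ Furthermore, for any $\hat{\mathbf{x}},\hat{\mathbf{y}}\in L_2^{n_0+n_1+n_2}$, we have $\mathcal{T}\hat{\mathbf{x}},\mathcal{T}\hat{\mathbf{y}}\in X$ and $\langle\mathcal{T}\hat{\mathbf{x}},\mathcal{T}\hat{\mathbf{y}}\rangle_X=\langle\hat{\mathbf{x}},\hat{\mathbf{y}}\rangle_{L_2}$.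
   Context: $L_2^m=L_2([a,b];\mathbb{R}^m)$ with its standard inner product; $H_k^m$ is the Sobolev space of $\mathbb{R}^m$-valued functions on $[a,b]$ whose weak derivatives up to order $k$ are in $L_2$. A subscript $s$ denotes $\partial_s$. 3-PI operators: for bounded measurable matrix-valued functions $N_0$ on $[a,b]$ and $N_1,N_2$ on $[a,b]^2$, $$(\mathcal{P}_{\{N_0,N_1,N_2\}}\mathbf{x})(s)=N_0(s)\mathbf{x}(s)+\int_a^s N_1(s,\theta)\mathbf{x}(\theta)\,d\theta+\int_s^b N_2(s,\theta)\mathbf{x}(\theta)\,d\theta .$$ The matrix $T\in\mathbb{R}^{(2n_1+4n_2)\times(n_1+2n_2)}$ is $$T=\begin{bmatrix} I_{n_1}&0&0\\ I_{n_1}&0&0\\ 0&I_{n_2}&0\\ 0&I_{n_2}&(b-a)I_{n_2}\\ 0&0&I_{n_2}\\ 0&0&I_{n_2}\end{bmatrix}.$$ The space $X$ is the set of $\mathbf{x}=(x_0,x_1,x_2)\in L_2^{n_0}\times H_1^{n_1}\times H_2^{n_2}$ such that $$B\begin{bmatrix} x_1(a)\\ x_1(b)\\ x_2(a)\\ x_2(b)\\ x_{2s}(a)\\ x_{2s}(b)\end{bmatrix}=0,$$ and $\langle\mathbf{x},\mathbf{y}\rangle_X=\langle x_0,y_0\rangle_{L_2}+\langle\partial_s x_1,\partial_s y_1\rangle_{L_2}+\langle\partial_s^2x_2,\partial_s^2y_2\rangle_{L_2}$. The operator $\mathrm{diag}(I,\partial_s,\partial_s^2)$ maps $(x_0,x_1,x_2)$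 to $(x_0,\partial_sx_1,\partial_s^2x_2)$. Define (columns of $Q$ and rows of $K$ partitioned as $n_0,n_1,n_2$; columns of $K$ partitioned as $n_1,n_2,n_2$) $$Q(s,\theta)=\begin{bmatrix} 0&0&0\\ 0&I_{n_1}&0\\ 0&0&0\\ 0&0&(b-\theta)I_{n_2}\\ 0&0&0\\ 0&0&I_{n_2}\end{bmatrix},\quad K(s)=\begin{bmatrix} 0&0&0\\ I_{n_1}&0&0\\ 0&I_{n_2}&(s-a)I_{n_2}\end{bmatrix},$$ $$G_0(s)=\begin{bmatrix} I_{n_0}&0&0\\ 0&0&0\\ 0&0&0\end{bmatrix},\quad G_2(s,\theta)=-K(s)(BT)^{-1}BQ(s,\theta),\quad G_1(s,\theta)=\begin{bmatrix} 0&0&0\\ 0&I_{n_1}&0\\ 0&0&(s-\theta)I_{n_2}\end{bmatrix}+G_2(s,\theta).$$ *)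

theory Defs
  imports "HOL-Analysis.Analysis" "Jordan_Normal_Form.Gauss_Jordan_Elimination"
begin

unbundle no vec_syntax
unbundle no inner_syntax

(* Vectors and matrices are those of Jordan_Normal_Form, since the dimensions
   may be 0. A function [a,b] -> R^m is a total function real => real vec of
   which only the values on {a..b} matter, and an element of L2 is represented
   by any function of its class: equality in L2 is equality almost everywhere. *)

section \<open>Lebesgue and Sobolev spaces of vector-valued functions on an interval\<close>

definition L2 :: "real \<Rightarrow> real \<Rightarrow> nat \<Rightarrow> (real \<Rightarrow> real vec) set" where
  "L2 a b m = {x. (\<forall>s\<in>{a..b}. x s \<in> carrier_vec m) \<and>
     (\<forall>i<m. (\<lambda>s. x s $ i) \<in> borel_measurable (lebesgue_on {a..b}) \<and>
            integrable (lebesgue_on {a..b}) (\<lambda>s. (x s $ i)\<^sup>2))}"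

definition L2_inner :: "real \<Rightarrow> real \<Rightarrow> (real \<Rightarrow> real vec) \<Rightarrow> (real \<Rightarrow> real vec) \<Rightarrow> real" where
  "L2_inner a b x y = (\<integral>s. x s \<bullet> y s \<partial>lebesgue_on {a..b})"

definition L2_eq :: "real \<Rightarrow> real \<Rightarrow> (real \<Rightarrow> real vec) \<Rightarrow> (real \<Rightarrow> real vec) \<Rightarrow> bool" where
  "L2_eq a b x y \<longleftrightarrow> (AE s in lebesgue_on {a..b}. x s = y s)"

definition test_functions :: "real \<Rightarrow> real \<Rightarrow> (real \<Rightarrow> real) set" where
  "test_functions a b = {\<phi>. (\<forall>k s. (deriv ^^ k) \<phi> differentiable (at s)) \<and>
     closure {s. \<phi> s \<noteq> 0} \<subseteq> {a<..<b}}"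

definition weak_deriv ::
  "real \<Rightarrow> real \<Rightarrow> nat \<Rightarrow> nat \<Rightarrow> (real \<Rightarrow> real vec) \<Rightarrow> (real \<Rightarrow> real vec) \<Rightarrow> bool" where
  "weak_deriv a b m k f g \<longleftrightarrow> (\<forall>\<phi>\<in>test_functions a b. \<forall>i<m.
     (\<integral>s. f s $ i * (deriv ^^ k) \<phi> s \<partial>lebesgue_on {a..b}) =
     (-1) ^ k * (\<integral>s. g s $ i * \<phi> s \<partial>lebesgue_on {a..b}))"

definition Sobolev :: "real \<Rightarrow> real \<Rightarrow> nat \<Rightarrow> nat \<Rightarrow> (real \<Rightarrow> real vec) set" where
  "Sobolev a b k m = {f \<in> L2 a b m. \<forall>j\<le>k. \<exists>g\<in>L2 a b m. weak_deriv a b m j f g}"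

(* A chosen representative of the k-th weak derivative, meaningful for elements
   of the Sobolev space of order k, where the derivative is unique up to
   equality almost everywhere. *)
definition wderiv :: "real \<Rightarrow> real \<Rightarrow> nat \<Rightarrow> nat \<Rightarrow> (real \<Rightarrow> real vec) \<Rightarrow> real \<Rightarrow> real vec" where
  "wderiv a b m k f = (SOME g. g \<in> L2 a b m \<and> weak_deriv a b m k f g)"

(* The value at t of an element of H_1 is that of its continuous representative,
   not that of the function f that happens to represent the class. *)
definition point_value :: "real \<Rightarrow> real \<Rightarrow> nat \<Rightarrow> (real \<Rightarrow> real vec) \<Rightarrow> real \<Rightarrow> real vec" where
  "point_value a b m f t = vec m (\<lambda>i.
     (SOME g :: real \<Rightarrow> real. continuous_on {a..b} g \<and>
        (AE s in lebesgue_on {a..b}. g s = f s $ i)) t)"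

section \<open>3-PI operators\<close>

definition vec_integral :: "nat \<Rightarrow> real set \<Rightarrow> (real \<Rightarrow> real vec) \<Rightarrow> real vec" where
  "vec_integral m S f = vec m (\<lambda>i. \<integral>\<theta>. f \<theta> $ i \<partial>lebesgue_on S)"

(* m is the number of rows of the kernels. *)
definition PI_op ::
  "real \<Rightarrow> real \<Rightarrow> nat \<Rightarrow> (real \<Rightarrow> real mat) \<Rightarrow> (real \<Rightarrow> real \<Rightarrow> real mat) \<Rightarrow>
   (real \<Rightarrow> real \<Rightarrow> real mat) \<Rightarrow> (real \<Rightarrow> real vec) \<Rightarrow> real \<Rightarrow> real vec" where
  "PI_op a b m N0 N1 N2 x s =
     N0 s *\<^sub>v x s
     + vec_integral m {a..s} (\<lambda>\<theta>. N1 s \<theta> *\<^sub>v x \<theta>)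
     + vec_integral m {s..b} (\<lambda>\<theta>. N2 s \<theta> *\<^sub>v x \<theta>)"

section \<open>The space X\<close>

definition append_cols :: "'a :: zero mat \<Rightarrow> 'a mat \<Rightarrow> 'a mat" (infixr \<open>@\<^sub>c\<close> 66) where
  "A @\<^sub>c B = four_block_mat A B (0\<^sub>m 0 (dim_col A)) (0\<^sub>m 0 (dim_col B))"

definition T_mat :: "real \<Rightarrow> real \<Rightarrow> nat \<Rightarrow> nat \<Rightarrow> real mat" where
  "T_mat a b n1 n2 =
     (1\<^sub>m n1    @\<^sub>c 0\<^sub>m n1 n2 @\<^sub>c 0\<^sub>m n1 n2) @\<^sub>r
     (1\<^sub>m n1    @\<^sub>c 0\<^sub>m n1 n2 @\<^sub>c 0\<^sub>m n1 n2) @\<^sub>r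
     (0\<^sub>m n2 n1 @\<^sub>c 1\<^sub>m n2    @\<^sub>c 0\<^sub>m n2 n2) @\<^sub>r
     (0\<^sub>m n2 n1 @\<^sub>c 1\<^sub>m n2    @\<^sub>c (b - a) \<cdot>\<^sub>m 1\<^sub>m n2) @\<^sub>r
     (0\<^sub>m n2 n1 @\<^sub>c 0\<^sub>m n2 n2 @\<^sub>c 1\<^sub>m n2) @\<^sub>r
     (0\<^sub>m n2 n1 @\<^sub>c 0\<^sub>m n2 n2 @\<^sub>c 1\<^sub>m n2)"

(* Elements (x0,x1,x2) of a product space are stacked into one vector-valued
   function; block k m extracts the m components starting at index k. *)
definition block :: "nat \<Rightarrow> nat \<Rightarrow> (real \<Rightarrow> real vec) \<Rightarrow> real \<Rightarrow> real vec" where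
  "block k m x s = vec m (\<lambda>i. x s $ (k + i))"

definition X_space :: "real \<Rightarrow> real \<Rightarrow> nat \<Rightarrow> nat \<Rightarrow> nat \<Rightarrow> real mat \<Rightarrow> (real \<Rightarrow> real vec) set" where
  "X_space a b n0 n1 n2 B = {x.
     (\<forall>s\<in>{a..b}. x s \<in> carrier_vec (n0 + n1 + n2)) \<and>
     (let x0 = block 0 n0 x; x1 = block n0 n1 x; x2 = block (n0 + n1) n2 x;
          x2s = wderiv a b n2 1 x2
      in x0 \<in> L2 a b n0 \<and> x1 \<in> Sobolev a b 1 n1 \<and> x2 \<in> Sobolev a b 2 n2 \<and>
         B *\<^sub>v (point_value a b n1 x1 a @\<^sub>v point_value a b n1 x1 b @\<^sub>v
               point_value a b n2 x2 a @\<^sub>v point_value a b n2 x2 b @\<^sub>v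
               point_value a b n2 x2s a @\<^sub>v point_value a b n2 x2s b)
         = 0\<^sub>v (n1 + 2 * n2))}"

definition X_inner ::
  "real \<Rightarrow> real \<Rightarrow> nat \<Rightarrow> nat \<Rightarrow> nat \<Rightarrow> (real \<Rightarrow> real vec) \<Rightarrow> (real \<Rightarrow> real vec) \<Rightarrow> real" where
  "X_inner a b n0 n1 n2 x y =
     L2_inner a b (block 0 n0 x) (block 0 n0 y)
     + L2_inner a b (wderiv a b n1 1 (block n0 n1 x)) (wderiv a b n1 1 (block n0 n1 y))
     + L2_inner a b (wderiv a b n2 2 (block (n0 + n1) n2 x)) (wderiv a b n2 2 (block (n0 + n1) n2 y))"

definition diag_deriv ::
  "real \<Rightarrow> real \<Rightarrow> nat \<Rightarrow> nat \<Rightarrow> nat \<Rightarrow> (real \<Rightarrow> real vec) \<Rightarrow> real \<Rightarrow> real vec" where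
  "diag_deriv a b n0 n1 n2 x s =
     block 0 n0 x s @\<^sub>v wderiv a b n1 1 (block n0 n1 x) s @\<^sub>v wderiv a b n2 2 (block (n0 + n1) n2 x) s"

section \<open>The kernels\<close>

definition Q_mat :: "real \<Rightarrow> nat \<Rightarrow> nat \<Rightarrow> nat \<Rightarrow> real \<Rightarrow> real \<Rightarrow> real mat" where
  "Q_mat b n0 n1 n2 s \<theta> =
     (0\<^sub>m n1 n0 @\<^sub>c 0\<^sub>m n1 n1 @\<^sub>c 0\<^sub>m n1 n2) @\<^sub>r
     (0\<^sub>m n1 n0 @\<^sub>c 1\<^sub>m n1    @\<^sub>c 0\<^sub>m n1 n2) @\<^sub>r
     (0\<^sub>m n2 n0 @\<^sub>c 0\<^sub>m n2 n1 @\<^sub>c 0\<^sub>m n2 n2) @\<^sub>r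
     (0\<^sub>m n2 n0 @\<^sub>c 0\<^sub>m n2 n1 @\<^sub>c (b - \<theta>) \<cdot>\<^sub>m 1\<^sub>m n2) @\<^sub>r
     (0\<^sub>m n2 n0 @\<^sub>c 0\<^sub>m n2 n1 @\<^sub>c 0\<^sub>m n2 n2) @\<^sub>r
     (0\<^sub>m n2 n0 @\<^sub>c 0\<^sub>m n2 n1 @\<^sub>c 1\<^sub>m n2)"

definition K_mat :: "real \<Rightarrow> nat \<Rightarrow> nat \<Rightarrow> nat \<Rightarrow> real \<Rightarrow> real mat" where
  "K_mat a n0 n1 n2 s =
     (0\<^sub>m n0 n1 @\<^sub>c 0\<^sub>m n0 n2 @\<^sub>c 0\<^sub>m n0 n2) @\<^sub>r
     (1\<^sub>m n1    @\<^sub>c 0\<^sub>m n1 n2 @\<^sub>c 0\<^sub>m n1 n2) @\<^sub>r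
     (0\<^sub>m n2 n1 @\<^sub>c 1\<^sub>m n2    @\<^sub>c (s - a) \<cdot>\<^sub>m 1\<^sub>m n2)"

definition G0 :: "nat \<Rightarrow> nat \<Rightarrow> nat \<Rightarrow> real \<Rightarrow> real mat" where
  "G0 n0 n1 n2 s =
     (1\<^sub>m n0    @\<^sub>c 0\<^sub>m n0 n1 @\<^sub>c 0\<^sub>m n0 n2) @\<^sub>r
     (0\<^sub>m n1 n0 @\<^sub>c 0\<^sub>m n1 n1 @\<^sub>c 0\<^sub>m n1 n2) @\<^sub>r
     (0\<^sub>m n2 n0 @\<^sub>c 0\<^sub>m n2 n1 @\<^sub>c 0\<^sub>m n2 n2)"

definition G2 :: "real \<Rightarrow> real \<Rightarrow> nat \<Rightarrow> nat \<Rightarrow> nat \<Rightarrow> real mat \<Rightarrow> real \<Rightarrow> real \<Rightarrow> real mat" where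
  "G2 a b n0 n1 n2 B s \<theta> =
     - (K_mat a n0 n1 n2 s * the (mat_inverse (B * T_mat a b n1 n2)) * B * Q_mat b n0 n1 n2 s \<theta>)"

definition G1 :: "real \<Rightarrow> real \<Rightarrow> nat \<Rightarrow> nat \<Rightarrow> nat \<Rightarrow> real mat \<Rightarrow> real \<Rightarrow> real \<Rightarrow> real mat" where
  "G1 a b n0 n1 n2 B s \<theta> =
     ((0\<^sub>m n0 n0 @\<^sub>c 0\<^sub>m n0 n1 @\<^sub>c 0\<^sub>m n0 n2) @\<^sub>r
      (0\<^sub>m n1 n0 @\<^sub>c 1\<^sub>m n1    @\<^sub>c 0\<^sub>m n1 n2) @\<^sub>r
      (0\<^sub>m n2 n0 @\<^sub>c 0\<^sub>m n2 n1 @\<^sub>c (s - \<theta>) \<cdot>\<^sub>m 1\<^sub>m n2))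
     + G2 a b n0 n1 n2 B s \<theta>"

definition T_op ::
  "real \<Rightarrow> real \<Rightarrow> nat \<Rightarrow> nat \<Rightarrow> nat \<Rightarrow> real mat \<Rightarrow> (real \<Rightarrow> real vec) \<Rightarrow> real \<Rightarrow> real vec" where
  "T_op a b n0 n1 n2 B =
     PI_op a b (n0 + n1 + n2) (G0 n0 n1 n2) (G1 a b n0 n1 n2 B) (G2 a b n0 n1 n2 B)"

end

(* By du Bois-Reymond's lemma, a function with weak derivative g equals, almost everywhere,
   a constant plus the primitive of g. Applied once to x1 and twice to x2, where the double
   primitive is rewritten as the integral of (s - t) g(t) over [a,s], this expresses x through
   its derivatives xh = (x0, x1_s, x2_ss) and the vector c = (x1(a), x2(a), x2_s(a)). The
   boundary values are then T c + q, with q the integral of Q xh over [a,b], so that the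
   boundary condition says precisely c = -(BT)^-1 B q, and K(s) c gives the terms with G2.
   Conversely, with this choice of c the formula defines an element of X whose derivatives
   are the components of xh; this yields the isometry. *)

theory Submission
  imports Defs
begin

section \<open>Smooth bumps and the fundamental lemma of the calculus of variations\<close>

text \<open>Elements of X are known only up to null sets, and \<open>wderiv\<close> and
  \<open>point_value\<close> are arbitrary choices. Each pointwise identity is therefore proved for
  a continuous representative, and uniqueness almost everywhere carries it to the chosen one.
  Uniqueness needs a rich supply of test functions, hence the start from exp(-1/x). Where the
  kernels come from: the functions with x0 = 0, x1 constant and x2 affine form the null space of
  diag(I, d, d^2), of dimension n1 + 2 n2. K(s) c runs through it, and T c lists its boundary
  values. Invertibility of BT says that only the zero function among them satisfies the boundary
  conditions. These conditions couple a and b, so c depends on xh over the whole interval, whereas a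
  3-PI operator offers integrals over [a,s] and [s,b]. Putting the same kernel G2 under both makes
  them add up to one integral over [a,b]; this is why G1 contains G2. The rest of G1 holds the
  kernels of the single and the double primitive.\<close>

definition smooth_upto :: "nat \<Rightarrow> (real \<Rightarrow> real) \<Rightarrow> bool" where
  "smooth_upto n f \<longleftrightarrow> (\<forall>k<n. \<forall>s. (deriv ^^ k) f differentiable (at s))"

lemma smooth_upto_0 [simp]: "smooth_upto 0 f"
  by (simp add: smooth_upto_def)

text \<open>Unfolding the iterates from the inside gives a recursion on the order. Closure under
  sums and products then follows by induction, each step spending one derivative.\<close>

lemma smooth_upto_Suc:
  "smooth_upto (Suc n) f \<longleftrightarrow> (\<forall>s. f differentiable (at s)) \<and> smooth_upto n (deriv f)"
  unfolding smooth_upto_def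
  by (auto simp: less_Suc_eq_0_disj funpow_Suc_right simp del: funpow.simps)

lemma differentiable_DERIV_deriv:
  fixes f :: "real \<Rightarrow> real"
  assumes "f differentiable (at s)"
  shows "(f has_real_derivative deriv f s) (at s)"
  using assms DERIV_deriv_iff_real_differentiable by blast

lemma smooth_upto_SucI:
  assumes "\<And>s. (f has_real_derivative g s) (at s)" "smooth_upto n g"
  shows "smooth_upto (Suc n) f"
proof -
  have "deriv f = g"
    using assms(1) by (intro ext DERIV_imp_deriv)
  then show ?thesis
    using assms by (auto simp: smooth_upto_Suc real_differentiable_def)
qed

lemma smooth_upto_mono: "smooth_upto n f \<Longrightarrow> m \<le> n \<Longrightarrow> smooth_upto m f"
  by (auto simp: smooth_upto_def)

lemma smooth_upto_add:
  "smooth_upto n f \<Longrightarrow> smooth_upto n g \<Longrightarrow> smooth_upto n (\<lambda>x. f x + g x)"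
proof (induction n arbitrary: f g)
  case (Suc n)
  then show ?case
    by (intro smooth_upto_SucI[where g = "\<lambda>x. deriv f x + deriv g x"] DERIV_add differentiable_DERIV_deriv)
      (auto simp: smooth_upto_Suc)
qed simp

lemma smooth_upto_mult:
  "smooth_upto n f \<Longrightarrow> smooth_upto n g \<Longrightarrow> smooth_upto n (\<lambda>x. f x * g x)"
proof (induction n arbitrary: f g)
  case (Suc n)
  then have "smooth_upto n f" "smooth_upto n g"
    by (auto intro: smooth_upto_mono)
  with Suc show ?case
    by (intro smooth_upto_SucI[where g = "\<lambda>x. deriv f x * g x + deriv g x * f x"]
        DERIV_mult differentiable_DERIV_deriv smooth_upto_add)
      (auto simp: smooth_upto_Suc)
qed simp

lemma smooth_upto_const: "smooth_upto n (\<lambda>x. c)"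
proof (induction n arbitrary: c)
  case (Suc n)
  then show ?case
    by (intro smooth_upto_SucI[where g = "\<lambda>x. 0"]) auto
qed simp

text \<open>Carrying a polynomial in 1/x along makes the family closed under differentiation, so
  that a single derivative rule covers all derivatives of exp(-1/x) extended by 0.\<close>

definition flat_exp :: "real poly \<Rightarrow> real \<Rightarrow> real" where
  "flat_exp p x = (if x > 0 then poly p (1 / x) * exp (- (1 / x)) else 0)"

lemma tendsto_poly_mult_exp_neg:
  "((\<lambda>y::real. poly p y * exp (- y)) \<longlongrightarrow> 0) at_top"
proof -
  have power: "((\<lambda>y::real. y ^ k * exp (- y)) \<longlongrightarrow> 0) at_top" for k
    using tendsto_power_div_exp_0[of k] by (simp add: exp_minus field_simps)
  \<comment> \<open>The factor y^k makes the induction go through: splitting off the constant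
    coefficient of p raises the power of y by one.\<close>
  have "((\<lambda>y::real. y ^ k * poly p y * exp (- y)) \<longlongrightarrow> 0) at_top" for k
  proof (induction p arbitrary: k)
    case (pCons c q)
    have "((\<lambda>y::real. c * (y ^ k * exp (- y)) + y ^ Suc k * poly q y * exp (- y)) \<longlongrightarrow> c * 0 + 0) at_top"
      by (intro tendsto_add tendsto_mult tendsto_const power pCons.IH)
    then show ?case by (simp add: algebra_simps)
  qed simp
  from this[of 0] show ?thesis by simp
qed

text \<open>For x > 0 the derivative is (p - p')(1/x) / x^2 times the exponential, and 1/x^2 is
  absorbed as the polynomial \<open>[:0, 0, 1:]\<close>.\<close>

lemma DERIV_flat_exp:
  "(flat_exp p has_real_derivative flat_exp ([:0, 0, 1:] * (p - pderiv p)) x) (at x)"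
proof (cases x "0::real" rule: linorder_cases)
  case less
  have "((\<lambda>x. 0) has_real_derivative 0) (at x)" by simp
  then have "(flat_exp p has_real_derivative 0) (at x)"
    by (rule has_field_derivative_transform_within_open[where S = "{..<0}"])
      (use less in \<open>auto simp: flat_exp_def\<close>)
  then show ?thesis using less by (simp add: flat_exp_def)
next
  case greater
  have "((\<lambda>x. poly p (1 / x) * exp (- (1 / x))) has_real_derivative
        flat_exp ([:0, 0, 1:] * (p - pderiv p)) x) (at x)"
    using greater
    by (auto intro!: derivative_eq_intros simp: flat_exp_def field_simps power2_eq_square)
  then show ?thesis
    by (rule has_field_derivative_transform_within_open[where S = "{0<..}"])
      (use greater in \<open>auto simp: flat_exp_def\<close>)
next
  case equal
  \<comment> \<open>At 0 the right difference quotient is (1/h) p(1/h) exp(-1/h), again a polynomial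
    in 1/h times the exponential; the left one is constantly 0.\<close>
  have "((\<lambda>h::real. poly (pCons 0 p) (inverse h) * exp (- inverse h)) \<longlongrightarrow> 0) (at_right 0)"
    using tendsto_poly_mult_exp_neg filterlim_inverse_at_top_right by (rule filterlim_compose)
  moreover have "\<forall>\<^sub>F h in at_right 0. poly (pCons 0 p) (inverse h) * exp (- inverse h)
      = (flat_exp p (0 + h) - flat_exp p 0) / h"
    by (auto simp: eventually_at_filter flat_exp_def field_simps)
  ultimately have "((\<lambda>h. (flat_exp p (0 + h) - flat_exp p 0) / h) \<longlongrightarrow> 0) (at_right 0)"
    by (rule Lim_transform_eventually)
  moreover have "((\<lambda>h. (flat_exp p (0 + h) - flat_exp p 0) / h) \<longlongrightarrow> 0) (at_left 0)"
    by (rule tendsto_eventually) (auto simp: eventually_at_filter flat_exp_def)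
  ultimately show ?thesis
    using equal by (simp add: DERIV_def filterlim_at_split flat_exp_def)
qed

text \<open>The induction runs over all p, since each derivative changes the polynomial; the affine
  map only contributes the constant factor \<alpha>.\<close>

lemma smooth_upto_flat_exp_affine: "smooth_upto n (\<lambda>x. flat_exp p (\<alpha> * x + \<beta>))"
proof (induction n arbitrary: p)
  case (Suc n)
  have "((\<lambda>x. flat_exp p (\<alpha> * x + \<beta>)) has_real_derivative
      flat_exp ([:0, 0, 1:] * (p - pderiv p)) (\<alpha> * s + \<beta>) * \<alpha>) (at s)" for s
    by (rule DERIV_chain2[OF DERIV_flat_exp]) (auto intro!: derivative_eq_intros)
  then show ?case
    by (rule smooth_upto_SucI) (intro smooth_upto_mult smooth_upto_const Suc)
qed simp

text \<open>One factor vanishes left of c, the other right of d. The parameter t steepens both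
  edges: as it grows, the height approaches 1 throughout the open interval, so no normalising
  constant is needed.\<close>

definition bump :: "real \<Rightarrow> real \<Rightarrow> real \<Rightarrow> real \<Rightarrow> real" where
  "bump c d t x = flat_exp 1 (t * (x - c)) * flat_exp 1 (t * (d - x))"

lemma smooth_upto_bump: "smooth_upto n (bump c d t)"
proof -
  have "bump c d t = (\<lambda>x. flat_exp 1 (t * x + (- t * c)) * flat_exp 1 ((- t) * x + t * d))"
    by (simp add: bump_def fun_eq_iff algebra_simps)
  then show ?thesis
    by (simp only: smooth_upto_mult smooth_upto_flat_exp_affine)
qed

lemma bump_bounds: "0 \<le> bump c d t x" "bump c d t x \<le> 1"
proof -
  have *: "0 \<le> flat_exp 1 y" "flat_exp 1 y \<le> 1" for y
    by (auto simp: flat_exp_def)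
  show "0 \<le> bump c d t x" "bump c d t x \<le> 1"
    unfolding bump_def using * by (auto intro!: mult_le_one)
qed

lemma bump_eq_0: "t > 0 \<Longrightarrow> x \<notin> {c<..<d} \<Longrightarrow> bump c d t x = 0"
  by (auto simp: bump_def flat_exp_def not_less zero_less_mult_iff)

lemma bump_tendsto_indicator:
  "(\<lambda>n. bump c d (real (Suc n)) x) \<longlonglongrightarrow> indicator {c<..<d} x"
proof (cases "x \<in> {c<..<d}")
  case True
  have *: "(\<lambda>n. flat_exp 1 (real (Suc n) * y)) \<longlonglongrightarrow> 1" if "y > 0" for y
  proof -
    have "(\<lambda>n. exp (- (inverse y * inverse (real (Suc n))))) \<longlonglongrightarrow> exp (- (inverse y * 0))"
      by (intro tendsto_intros LIMSEQ_inverse_real_of_nat)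
    moreover have "flat_exp 1 (real (Suc n) * y) = exp (- (inverse y * inverse (real (Suc n))))" for n
      using that by (simp add: flat_exp_def field_simps del: of_nat_Suc)
    ultimately show ?thesis by simp
  qed
  have "(\<lambda>n. bump c d (real (Suc n)) x) \<longlonglongrightarrow> 1 * 1"
    unfolding bump_def using True by (intro tendsto_mult *) auto
  then show ?thesis using True by simp
next
  case False
  then have "bump c d (real (Suc n)) x = 0" for n
    by (intro bump_eq_0) auto
  then show ?thesis using False by simp
qed

section \<open>Test functions and their supports\<close>

lemma test_functions_altdef:
  "\<phi> \<in> test_functions a b \<longleftrightarrow>
     (\<forall>n. smooth_upto n \<phi>) \<and> closure {s. \<phi> s \<noteq> 0} \<subseteq> {a<..<b}"
  by (auto simp: test_functions_def smooth_upto_def)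

lemma test_functionsI:
  assumes "\<And>n. smooth_upto n \<phi>" "a < c" "d < b" "\<And>s. s \<notin> {c..d} \<Longrightarrow> \<phi> s = 0"
  shows "\<phi> \<in> test_functions a b"
proof -
  have "closure {s. \<phi> s \<noteq> 0} \<subseteq> {c..d}"
    using assms(4) by (intro closure_minimal) force+
  with assms(1-3) show ?thesis
    by (auto simp: test_functions_altdef)
qed

text \<open>The closed support is bounded, hence compact, so it has a least and a greatest point,
  both strictly inside the interval.\<close>

lemma test_functions_support:
  assumes "\<phi> \<in> test_functions a b" "a < b"
  obtains c d where "a < c" "c \<le> d" "d < b" "\<And>s. s \<notin> {c..d} \<Longrightarrow> \<phi> s = 0"
proof (cases "{s. \<phi> s \<noteq> 0} = {}")
  case True
  \<comment> \<open>The zero function has empty support; the midpoint serves as a degenerate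
    interval.\<close>
  then show ?thesis
    using that[of "(a+b)/2" "(a+b)/2"] assms(2) by auto
next
  case False
  let ?S = "closure {s. \<phi> s \<noteq> 0}"
  have S: "?S \<subseteq> {a<..<b}" using assms by (simp add: test_functions_altdef)
  have "bounded ?S" using S bounded_subset bounded_box(1)[of a b] by (metis box_real(1))
  then have S': "compact ?S" by (simp add: compact_eq_bounded_closed)
  have ne: "?S \<noteq> {}" using False by simp
  obtain c where c: "c \<in> ?S" "\<forall>s\<in>?S. c \<le> s"
    using compact_attains_inf[OF S' ne] by (elim bexE)
  obtain d where d: "d \<in> ?S" "\<forall>s\<in>?S. s \<le> d"
    using compact_attains_sup[OF S' ne] by (elim bexE)
  have "s \<in> ?S" if "\<phi> s \<noteq> 0" for s
    using that by (intro subsetD[OF closure_subset]) simp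
  then have "\<phi> s = 0" if "s \<notin> {c..d}" for s
    using c(2) d(2) that by auto
  moreover have "a < c" "d < b" "c \<le> d" using c d S by auto
  ultimately show ?thesis using that[of c d] by simp
qed

lemma test_functions_DERIV:
  assumes "\<phi> \<in> test_functions a b"
  shows "(\<phi> has_real_derivative deriv \<phi> s) (at s)"
proof -
  have "smooth_upto (Suc 0) \<phi>" using assms by (simp add: test_functions_altdef)
  then show ?thesis by (intro differentiable_DERIV_deriv) (auto simp: smooth_upto_Suc)
qed

lemma test_functions_continuous: "\<phi> \<in> test_functions a b \<Longrightarrow> continuous_on S \<phi>"
  by (intro continuous_at_imp_continuous_on ballI DERIV_isCont[OF test_functions_DERIV])

lemma test_functions_eq_0: "\<phi> \<in> test_functions a b \<Longrightarrow> s \<notin> {a<..<b} \<Longrightarrow> \<phi> s = 0"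
  using closure_subset[of "{s. \<phi> s \<noteq> 0}"] by (auto simp: test_functions_altdef)

text \<open>Off its closed support \<phi> vanishes on an open set, so the derivative vanishes there
  too and the support does not grow.\<close>

lemma test_functions_deriv:
  assumes "\<phi> \<in> test_functions a b"
  shows "deriv \<phi> \<in> test_functions a b"
proof -
  have "deriv \<phi> s = 0" if "s \<notin> closure {s. \<phi> s \<noteq> 0}" for s
  proof -
    have "((\<lambda>x. 0) has_real_derivative 0) (at s)" by simp
    then have "(\<phi> has_real_derivative 0) (at s)"
      by (rule has_field_derivative_transform_within_open[where S = "- closure {s. \<phi> s \<noteq> 0}"])
        (use that closure_subset[of "{s. \<phi> s \<noteq> 0}"] in auto)
    then show ?thesis by (rule DERIV_imp_deriv)
  qed
  then have "closure {s. deriv \<phi> s \<noteq> 0} \<subseteq> closure {s. \<phi> s \<noteq> 0}"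
    by (intro closure_minimal) auto
  moreover have "smooth_upto n (deriv \<phi>)" for n
    using assms smooth_upto_Suc[of n \<phi>] by (simp add: test_functions_altdef)
  ultimately show ?thesis
    using assms by (auto simp: test_functions_altdef)
qed

lemma bump_test_function: 
  assumes "a < c" "d < b" "t > 0"
  shows "bump c d t \<in> test_functions a b"
  using assms by (intro test_functionsI[where c = c and d = d] smooth_upto_bump bump_eq_0) auto

section \<open>Integrability on compact intervals\<close>

lemma integrable_mult_continuous:
  fixes f g :: "real \<Rightarrow> real"
  assumes f: "integrable (lebesgue_on {a..b}) f" and g: "continuous_on {a..b} g"
  shows "integrable (lebesgue_on {a..b}) (\<lambda>s. f s * g s)"
proof -
  obtain M where M: "\<And>x. x \<in> {a..b} \<Longrightarrow> norm (g x) \<le> M"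
    using compact_imp_bounded[OF compact_continuous_image[OF g]] by (force simp: bounded_iff)
  have "g \<in> borel_measurable (lebesgue_on {a..b})"
    using g by (rule continuous_imp_measurable_on_sets_lebesgue) auto
  then show ?thesis
    using f M
    by (intro Bochner_Integration.integrable_bound[of _ "\<lambda>x. M * f x" "\<lambda>s. f s * g s"] AE_I2
        borel_measurable_times)
      (auto simp: abs_mult mult.commute[of "\<bar>f _\<bar>"] intro!: mult_right_mono intro: order_trans[OF _ abs_ge_self])
qed

lemma integrable_lebesgue_on_subinterval:
  fixes f :: "real \<Rightarrow> real"
  assumes f: "integrable (lebesgue_on {a..b}) f" and "a \<le> c" "d \<le> b"
  shows "integrable (lebesgue_on {c..d}) f"
proof -
  have "set_integrable lebesgue {a..b} f"
    using f by (simp add: set_integrable_def integrable_restrict_space)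
  then have "set_integrable lebesgue {c..d} f"
    by (rule set_integrable_subset) (use assms in auto)
  then show ?thesis
    by (simp add: set_integrable_def integrable_restrict_space)
qed

lemma AE_lebesgue_onI_negligible:
  assumes "negligible N" "S \<in> sets lebesgue" "\<And>x. x \<in> S \<Longrightarrow> x \<notin> N \<Longrightarrow> P x"
  shows "AE x in lebesgue_on S. P x"
proof -
  have "AE x in lebesgue. x \<notin> N"
    using assms(1) by (intro AE_not_in) (simp add: negligible_iff_null_sets)
  then show ?thesis
    using assms by (auto simp: AE_restrict_space_iff)
qed

text \<open>Lebesgue differentiation: at almost every x the averages over [x, x + e] tend to the
  value at x, and here all short averages are 0.\<close>

lemma subinterval_integrals_zero_imp_AE_zero:
  fixes h :: "real \<Rightarrow> real"
  assumes h: "integrable (lebesgue_on {a..b}) h"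
    and z: "\<And>c d. a < c \<Longrightarrow> c < d \<Longrightarrow> d < b \<Longrightarrow> integral {c..d} h = 0"
  shows "AE s in lebesgue_on {a..b}. h s = 0"
proof -
  \<comment> \<open>Extension by 0 makes h integrable over every interval, as the differentiation
    theorem demands.\<close>
  define h0 where "h0 = (\<lambda>x. if x \<in> {a..b} then h x else 0)"
  have hi: "h integrable_on {a..b}" using h by (intro integrable_on_lebesgue_on) auto
  have "h0 integrable_on cbox c d" for c d
  proof -
    have "h0 integrable_on {a..b}" using hi by (rule integrable_eq) (simp add: h0_def)
    then have "h0 integrable_on {min a c..max b d}"
      by (rule integrable_on_superset) (auto simp: h0_def)
    then show ?thesis
      using integrable_on_subinterval[of h0 "{min a c..max b d}" c d] by force
  qed
  then obtain N where N: "negligible N" 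
    "\<And>x e. \<lbrakk>x \<notin> N; 0 < e\<rbrakk> \<Longrightarrow> \<exists>d>0. \<forall>h. 0 < h \<and> h < d \<longrightarrow>
      norm(integral (cbox x (x + h *\<^sub>R One)) h0 /\<^sub>R h ^ DIM(real) - h0 x) < e"
    by (rule integrable_ccontinuous_explicit) blast
  show ?thesis
  proof (rule AE_lebesgue_onI_negligible)
    \<comment> \<open>The endpoints are discarded because the hypothesis speaks only of intervals
      inside the open interval.\<close>
    show "negligible (N \<union> {a, b})" using N(1) by auto
  next
    fix x assume x: "x \<in> {a..b}" "x \<notin> N \<union> {a, b}"
    show "h x = 0"
    proof (rule ccontr)
      assume "h x \<noteq> 0"
      then obtain d where d: "d > 0" "\<And>e. 0 < e \<Longrightarrow> e < d \<Longrightarrow>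
          norm(integral (cbox x (x + e *\<^sub>R One)) h0 /\<^sub>R e ^ DIM(real) - h0 x) < \<bar>h x\<bar>"
        using N(2)[of x "\<bar>h x\<bar>"] x by auto
      \<comment> \<open>Halving keeps e below d and x + e below b at once.\<close>
      define e where "e = min d (b - x) / 2"
      have e: "0 < e" "e < d" "x + e < b" using d(1) x by (auto simp: e_def min_def field_simps)
      have "integral {x..x + e} h0 = integral {x..x + e} h"
        by (rule integral_cong) (use x e in \<open>auto simp: h0_def\<close>)
      also have "\<dots> = 0" using x e by (intro z) auto
      finally show False using d(2)[OF e(1,2)] x by (simp add: h0_def)
    qed
  qed auto
qed

text \<open>The bumps converge boundedly to the indicator of an open subinterval.\<close>
lemma fundamental_lemma_variations:
  assumes h: "integrable (lebesgue_on {a..b}) h"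
    and z: "\<And>\<phi>. \<phi> \<in> test_functions a b \<Longrightarrow> (\<integral>s. h s * \<phi> s \<partial>lebesgue_on {a..b}) = 0"
  shows "AE s in lebesgue_on {a..b}. h s = 0"
  using h
proof (rule subinterval_integrals_zero_imp_AE_zero)
  fix c d assume cd: "a < c" "c < d" "d < b"
  let ?g = "\<lambda>s. h s * indicator {c<..<d} s :: real"
  have bump: "bump c d (real (Suc n)) \<in> test_functions a b" for n
    using cd by (intro bump_test_function) auto
  have meas: "(\<lambda>s. h s * bump c d (real (Suc n)) s) \<in> borel_measurable (lebesgue_on {a..b})" for n
    using integrable_mult_continuous[OF h test_functions_continuous[OF bump]] by auto
  have meas': "?g \<in> borel_measurable (lebesgue_on {a..b})"
    using h cd
    by (intro borel_measurable_integrable integrable_real_mult_indicator)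
      (auto simp: sets_restrict_space_iff)
  have "(\<lambda>n. \<integral>s. h s * bump c d (real (Suc n)) s \<partial>lebesgue_on {a..b})
      \<longlonglongrightarrow> (\<integral>s. ?g s \<partial>lebesgue_on {a..b})"
    using h meas meas'
    by (intro integral_dominated_convergence[where w = "\<lambda>s. norm (h s)"] AE_I2
        tendsto_mult tendsto_const bump_tendsto_indicator)
      (auto simp: abs_mult bump_bounds mult_left_le simp del: of_nat_Suc)
  moreover have "(\<integral>s. h s * bump c d (real (Suc n)) s \<partial>lebesgue_on {a..b}) = 0" for n
    using bump by (rule z)
  ultimately have 0: "(\<integral>s. ?g s \<partial>lebesgue_on {a..b}) = 0"
    by (simp add: LIMSEQ_const_iff)
  have "integrable (lebesgue_on {a..b}) ?g"
    using h cd by (intro integrable_real_mult_indicator) (auto simp: sets_restrict_space_iff)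
  then have "(\<integral>s. ?g s \<partial>lebesgue_on {a..b}) = integral {a..b} ?g"
    by (intro lebesgue_integral_eq_integral) auto
  also have "\<dots> = integral {a..b} (\<lambda>s. if s \<in> {c<..<d} then h s else 0)"
    by (rule integral_cong) auto
  also have "\<dots> = integral {c<..<d} h"
    using cd by (subst integral_restrict_Int) (auto simp: Int_absorb2 intro!: arg_cong2[where f = integral])
  also have "\<dots> = integral {c..d} h"
    by (simp add: integral_open_interval_real)
  finally show "integral {c..d} h = 0" using 0 by simp
qed

section \<open>Primitives and weak derivatives\<close>

lemma LINT_lebesgue_on_eq_integral:
  fixes f :: "real \<Rightarrow> real"
  assumes "integrable (lebesgue_on {a..b}) f" "a \<le> c" "d \<le> b"
  shows "(\<integral>s. f s \<partial>lebesgue_on {c..d}) = integral {c..d} f"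
  using integrable_lebesgue_on_subinterval[OF assms] by (intro lebesgue_integral_eq_integral) auto

lemma LINT_lebesgue_on_split:
  fixes f :: "real \<Rightarrow> real"
  assumes "integrable (lebesgue_on {a..b}) f" "s \<in> {a..b}"
  shows "(\<integral>t. f t \<partial>lebesgue_on {a..s}) + (\<integral>t. f t \<partial>lebesgue_on {s..b})
    = (\<integral>t. f t \<partial>lebesgue_on {a..b})"
proof -
  have "f integrable_on {a..b}" using assms by (intro integrable_on_lebesgue_on) auto
  then have "integral {a..s} f + integral {s..b} f = integral {a..b} f"
    using assms by (intro Henstock_Kurzweil_Integration.integral_combine) auto
  then show ?thesis
    using assms by (simp add: LINT_lebesgue_on_eq_integral[OF assms(1)])
qed

lemma continuous_on_primitive:
  fixes f :: "real \<Rightarrow> real"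
  assumes "integrable (lebesgue_on {a..b}) f"
  shows "continuous_on {a..b} (\<lambda>s. \<integral>t. f t \<partial>lebesgue_on {a..s})"
proof (rule continuous_on_eq)
  show "continuous_on {a..b} (\<lambda>s. integral {a..s} f)"
    using assms by (intro indefinite_integral_continuous_1 integrable_on_lebesgue_on) auto
qed (use assms in \<open>auto simp: LINT_lebesgue_on_eq_integral\<close>)

text \<open>Fubini is applied over \<open>lborel\<close>, while the spaces are built over
  \<open>lebesgue_on\<close>; a Borel integrand that agrees almost everywhere carries the value from
  one to the other.\<close>

lemma LINT_lborel_eq_LINT_lebesgue_on:
  fixes f h :: "real \<Rightarrow> real"
  assumes "integrable lborel f" "integrable (lebesgue_on S) h" "S \<in> sets lebesgue"
    and "AE x in lborel. f x = indicator S x * h x"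
  shows "(\<integral>x. f x \<partial>lborel) = (\<integral>x. h x \<partial>lebesgue_on S)"
proof -
  have hS: "integrable lebesgue (\<lambda>x. indicator S x * h x)"
    using assms(2,3) by (simp add: integrable_restrict_space)
  have "(\<integral>x. f x \<partial>lborel) = (\<integral>x. f x \<partial>lebesgue)"
    using assms(1) by (simp add: integral_completion borel_measurable_integrable)
  also have "\<dots> = (\<integral>x. indicator S x * h x \<partial>lebesgue)"
  proof (rule integral_cong_AE)
    show "f \<in> borel_measurable lebesgue"
      using assms(1) by (intro measurable_completion) auto
  qed (use hS AE_completion[OF assms(4)] in auto)
  also have "\<dots> = (\<integral>x. h x \<partial>lebesgue_on S)"
    using assms(3) by (simp add: integral_restrict_space)
  finally show ?thesis .
qed

text \<open>Only \<open>\<psi>\<close> is differentiable here, so the product rule is not available; instead both sides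
  are the integral of \<open>g t * \<psi>' u\<close> over the triangle \<open>a \<le> t \<le> u \<le> b\<close>.\<close>
lemma integration_by_parts_primitive:
  fixes g \<psi> \<psi>' :: "real \<Rightarrow> real"
  assumes g: "integrable (lebesgue_on {a..b}) g" and "a \<le> b"
    and \<psi>: "\<And>s. (\<psi> has_real_derivative \<psi>' s) (at s)" and \<psi>': "continuous_on UNIV \<psi>'"
  shows "(\<integral>t. g t * \<psi> t \<partial>lebesgue_on {a..b})
    = (\<integral>t. g t \<partial>lebesgue_on {a..b}) * \<psi> b
      - (\<integral>u. (\<integral>t. g t \<partial>lebesgue_on {a..u}) * \<psi>' u \<partial>lebesgue_on {a..b})"
proof -
  have \<psi>c: "continuous_on S \<psi>" for S
    using \<psi> by (intro continuous_at_imp_continuous_on) (auto intro: DERIV_isCont)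
  have "integrable lebesgue (\<lambda>t. indicator {a..b} t * g t)"
    using g by (simp add: integrable_restrict_space)
  \<comment> \<open>A Borel version of g is taken so that the integrand on the product
    \<open>lborel \<Otimes>\<^sub>M lborel\<close> is measurable.\<close>
  then obtain g' where g'm [measurable]: "g' \<in> borel_measurable lborel"
      and g': "AE t in lborel. indicator {a..b} t * g t = g' t"
    using completion_ex_borel_measurable_real borel_measurable_integrable by blast
  define G where "G t = indicator {a..b} t * g' t" for t
  define P where "P u = indicator {a..b} u * \<psi>' u" for u
  define F where "F u = (\<integral>t. g t \<partial>lebesgue_on {a..u})" for u
  have G_AE: "AE t in lborel. G t = indicator {a..b} t * g t"
    using g' by eventually_elim (auto simp: G_def indicator_def of_bool_def split: if_splits)
  have [measurable]: "G \<in> borel_measurable lborel"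
    unfolding G_def by measurable
  have [measurable]: "\<psi>' \<in> borel_measurable lborel"
    using borel_measurable_continuous_onI[OF \<psi>'] by simp
  have [measurable]: "P \<in> borel_measurable lborel"
    unfolding P_def by measurable
  have "integrable lebesgue G"
  proof (rule integrable_cong_AE_imp)
    show "integrable lebesgue (\<lambda>t. indicator {a..b} t * g t)" by fact
    show "G \<in> borel_measurable lebesgue" by (intro measurable_completion) measurable
    show "AE t in lebesgue. indicator {a..b} t * g t = G t" 
      using AE_completion[OF G_AE] by eventually_elim simp
  qed
  then have G_int: "integrable lborel G"
    by (simp add: integrable_completion)
  have P_int: "integrable lborel P"
    using borel_integrable_atLeastAtMost'[of a b \<psi>'] continuous_on_subset[OF \<psi>']
    by (simp add: set_integrable_def P_def[abs_def])
  \<comment> \<open>The indicator encodes the condition t \<le> u; the interval bounds are already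
    absorbed into \<open>G\<close> and \<open>P\<close>.\<close>
  let ?k = "\<lambda>t u. indicator {z. fst z \<le> snd z} (t, u) * (G t * P u)"
  have tri [measurable]: "{z::real \<times> real. fst z \<le> snd z} \<in> sets (lborel \<Otimes>\<^sub>M lborel)"
  proof -
    have "closed {z::real \<times> real. fst z \<le> snd z}"
      by (intro closed_Collect_le continuous_intros)
    then show ?thesis by (metis borel_closed lborel_prod sets_lborel)
  qed
  have "integrable (lborel \<Otimes>\<^sub>M lborel) (\<lambda>(t, u). G t * P u)"
    using G_int P_int by (intro lborel_pair.Fubini_integrable) (auto simp: abs_mult)
  then have k_int: "integrable (lborel \<Otimes>\<^sub>M lborel) (case_prod ?k)"
    using integrable_mult_indicator[OF tri, of "\<lambda>(t, u). G t * P u"] by (simp add: case_prod_unfold)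
  \<comment> \<open>Integrating over u first leaves \<psi>' on [t, b], to which the fundamental
    theorem of calculus applies; integrating over t first leaves the primitive
    \<open>F\<close>.\<close>
  have inner_u: "(\<integral>u. ?k t u \<partial>lborel) = G t * (\<psi> b - \<psi> t)" for t
  proof (cases "t \<in> {a..b}")
    case True
    have "(\<integral>u. ?k t u \<partial>lborel) = (\<integral>u. G t * (indicator {t..b} u *\<^sub>R \<psi>' u) \<partial>lborel)"
      using True by (intro Bochner_Integration.integral_cong) (auto simp: P_def indicator_def)
    also have "\<dots> = G t * (\<integral>u. indicator {t..b} u *\<^sub>R \<psi>' u \<partial>lborel)"
      by (rule integral_mult_right_zero)
    also have "(\<integral>u. indicator {t..b} u *\<^sub>R \<psi>' u \<partial>lborel) = \<psi> b - \<psi> t"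
    proof (rule integral_FTC_atLeastAtMost)
      show "(\<psi> has_vector_derivative \<psi>' x) (at x within {t..b})" for x
        using \<psi> by (meson DERIV_subset has_real_derivative_iff_has_vector_derivative subset_UNIV)
    qed (use True continuous_on_subset[OF \<psi>'] in auto)
    finally show ?thesis .
  qed (simp add: G_def)
  have inner_t: "(\<integral>t. ?k t u \<partial>lborel) = indicator {a..b} u * (F u * \<psi>' u)" for u
  proof (cases "u \<in> {a..b}")
    case True
    have "(\<integral>t. ?k t u \<partial>lborel) = (\<integral>t. \<psi>' u * (indicator {a..u} t * G t) \<partial>lborel)"
      using True by (intro Bochner_Integration.integral_cong) (auto simp: P_def G_def indicator_def)
    also have "\<dots> = \<psi>' u * (\<integral>t. indicator {a..u} t * G t \<partial>lborel)"
      by (rule integral_mult_right_zero)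
    also have "(\<integral>t. indicator {a..u} t * G t \<partial>lborel) = F u"
      unfolding F_def
    proof (rule LINT_lborel_eq_LINT_lebesgue_on)
      show "integrable lborel (\<lambda>t. indicator {a..u} t * G t)"
        using integrable_mult_indicator[OF _ G_int, of "{a..u}"] by simp
      show "integrable (lebesgue_on {a..u}) g"
        using g by (rule integrable_lebesgue_on_subinterval) (use True in auto)
      show "AE t in lborel. indicator {a..u} t * G t = indicator {a..u} t * g t"
        using G_AE by eventually_elim (use True in \<open>auto simp: indicator_def\<close>)
    qed simp
    finally show ?thesis using True by simp
  qed (simp add: P_def)
  have "(\<integral>t. (\<integral>u. ?k t u \<partial>lborel) \<partial>lborel) = (\<integral>u. (\<integral>t. ?k t u \<partial>lborel) \<partial>lborel)"
    using lborel_pair.Fubini_integral[OF k_int] by (rule sym)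
  also have "(\<integral>t. (\<integral>u. ?k t u \<partial>lborel) \<partial>lborel) = (\<integral>t. g t * (\<psi> b - \<psi> t) \<partial>lebesgue_on {a..b})"
  proof (rule LINT_lborel_eq_LINT_lebesgue_on)
    show "integrable lborel (\<lambda>t. \<integral>u. ?k t u \<partial>lborel)"
      by (rule lborel_pair.integrable_fst[OF k_int])
    show "integrable (lebesgue_on {a..b}) (\<lambda>t. g t * (\<psi> b - \<psi> t))"
      using g by (rule integrable_mult_continuous) (intro continuous_intros \<psi>c)
    show "AE t in lborel. (\<integral>u. ?k t u \<partial>lborel) = indicator {a..b} t * (g t * (\<psi> b - \<psi> t))"
      unfolding inner_u using G_AE by eventually_elim simp
  qed simp
  also have "(\<integral>u. (\<integral>t. ?k t u \<partial>lborel) \<partial>lborel) = (\<integral>u. F u * \<psi>' u \<partial>lebesgue_on {a..b})"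
  proof (rule LINT_lborel_eq_LINT_lebesgue_on)
    show "integrable lborel (\<lambda>u. \<integral>t. ?k t u \<partial>lborel)"
      by (rule lborel_pair.integrable_snd[OF k_int])
    show "integrable (lebesgue_on {a..b}) (\<lambda>u. F u * \<psi>' u)"
      unfolding F_def
      by (intro continuous_imp_integrable_real continuous_on_mult continuous_on_primitive g
          continuous_on_subset[OF \<psi>']) auto
  qed (simp_all add: inner_t)
  finally have "(\<integral>t. g t * (\<psi> b - \<psi> t) \<partial>lebesgue_on {a..b}) = (\<integral>u. F u * \<psi>' u \<partial>lebesgue_on {a..b})" .
  moreover have "(\<integral>t. g t * (\<psi> b - \<psi> t) \<partial>lebesgue_on {a..b})
      = (\<integral>t. g t * \<psi> b - g t * \<psi> t \<partial>lebesgue_on {a..b})"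
    by (simp add: algebra_simps)
  moreover have "\<dots> = (\<integral>t. g t \<partial>lebesgue_on {a..b}) * \<psi> b - (\<integral>t. g t * \<psi> t \<partial>lebesgue_on {a..b})"
    using g by (subst Bochner_Integration.integral_diff)
      (auto intro!: integrable_mult_continuous \<psi>c)
  ultimately show ?thesis
    by (simp add: F_def)
qed

text \<open>Integration by parts against \<psi> t = s - t: the boundary term vanishes at t = s, and
  \<psi>' = -1 turns the remaining integral into that of the primitive. This is Cauchy's formula for
  repeated integration.\<close>

lemma double_primitive:
  fixes g :: "real \<Rightarrow> real"
  assumes g: "integrable (lebesgue_on {a..b}) g" and s: "s \<in> {a..b}"
  shows "(\<integral>u. (\<integral>t. g t \<partial>lebesgue_on {a..u}) \<partial>lebesgue_on {a..s})
    = (\<integral>t. (s - t) * g t \<partial>lebesgue_on {a..s})"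
proof -
  have "integrable (lebesgue_on {a..s}) g"
    using g by (rule integrable_lebesgue_on_subinterval) (use s in auto)
  then have "(\<integral>t. g t * (s - t) \<partial>lebesgue_on {a..s})
    = (\<integral>t. g t \<partial>lebesgue_on {a..s}) * (s - s)
      - (\<integral>u. (\<integral>t. g t \<partial>lebesgue_on {a..u}) * (- 1) \<partial>lebesgue_on {a..s})"
    by (rule integration_by_parts_primitive) (use s in \<open>auto intro!: derivative_eq_intros\<close>)
  then show ?thesis by (simp add: mult.commute)
qed

text \<open>The continuous function |f - g| has integral 0. Here a < b is essential: on a single
  point everything holds almost everywhere.\<close>

lemma continuous_AE_eq_imp_eq:
  fixes f g :: "real \<Rightarrow> real"
  assumes "a < b" "continuous_on {a..b} f" "continuous_on {a..b} g"
    and "AE s in lebesgue_on {a..b}. f s = g s" "s \<in> {a..b}"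
  shows "f s = g s"
proof -
  let ?h = "\<lambda>s. \<bar>f s - g s\<bar>"
  have c: "continuous_on {a..b} ?h" by (intro continuous_intros assms)
  have "integral {a..b} ?h = (\<integral>s. ?h s \<partial>lebesgue_on {a..b})"
    using continuous_imp_integrable_real[OF c] by (simp add: LINT_lebesgue_on_eq_integral)
  also have "\<dots> = 0"
    by (rule integral_eq_zero_AE) (use assms(4) in auto)
  finally have "\<forall>s\<in>{a..b}. ?h s = 0"
    using c assms(1) by (subst (asm) integral_eq_0_iff) auto
  then show ?thesis using assms by auto
qed

section \<open>Primitives of test functions and du Bois-Reymond's lemma\<close>

lemma test_functions_cmult_add:
  assumes "\<phi> \<in> test_functions a b" "\<psi> \<in> test_functions a b" "a < b"
  shows "(\<lambda>s. \<phi> s + \<kappa> * \<psi> s) \<in> test_functions a b"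
proof -
  obtain c d where cd: "a < c" "c \<le> d" "d < b" "\<And>s. s \<notin> {c..d} \<Longrightarrow> \<phi> s = 0"
    using test_functions_support[OF assms(1,3)] by metis
  obtain c' d' where cd': "a < c'" "c' \<le> d'" "d' < b" "\<And>s. s \<notin> {c'..d'} \<Longrightarrow> \<psi> s = 0"
    using test_functions_support[OF assms(2,3)] by metis
  show ?thesis
  proof (rule test_functionsI)
    show "a < min c c'" "max d d' < b" using cd cd' by auto
    show "\<phi> s + \<kappa> * \<psi> s = 0" if "s \<notin> {min c c'..max d d'}" for s
      using that cd(4)[of s] cd'(4)[of s] by (cases "s \<in> {c..d}"; cases "s \<in> {c'..d'}") auto
  qed (use assms in \<open>auto simp: test_functions_altdef intro!: smooth_upto_add smooth_upto_mult smooth_upto_const\<close>)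
qed

text \<open>Left of the support the primitive is still 0; right of it the primitive has collected
  the whole integral, which is 0 by assumption. So it has compact support too.\<close>

lemma test_functions_primitive:
  assumes p: "p \<in> test_functions a b" and "a < b" and int: "(\<integral>s. p s \<partial>lebesgue_on {a..b}) = 0"
  obtains \<phi> where "\<phi> \<in> test_functions a b" "deriv \<phi> = p"
proof -
  obtain c d where cd: "a < c" "c \<le> d" "d < b" "\<And>s. s \<notin> {c..d} \<Longrightarrow> p s = 0"
    using test_functions_support[OF p assms(2)] by metis
  define \<phi> where "\<phi> s = (if s \<in> {a..b} then integral {a..s} p else 0)" for s
  have pc: "continuous_on S p" for S using p by (rule test_functions_continuous)
  have pi: "integrable (lebesgue_on {a..b}) p" by (rule continuous_imp_integrable_real[OF pc])
  have zero: "\<phi> s = 0" if "s \<notin> {c..d}" for s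
  proof (cases "s \<in> {a..b}")
    case s: True
    show ?thesis
    proof (cases "s < c")
      case True
      have "integral {a..s} p = integral {a..s} (\<lambda>x. 0)"
        by (rule integral_cong) (use True cd(4) in auto)
      then show ?thesis by (simp add: \<phi>_def)
    next
      case False
      then have "s > d" using that by auto
      have "integral {a..s} p + integral {s..b} p = integral {a..b} p"
        using s by (intro Henstock_Kurzweil_Integration.integral_combine integrable_continuous_interval pc) auto
      also have "\<dots> = 0" using int pi by (simp add: LINT_lebesgue_on_eq_integral)
      also have "integral {s..b} p = integral {s..b} (\<lambda>x. 0)"
        by (rule integral_cong) (use \<open>s > d\<close> cd(4) in auto)
      finally show ?thesis by (simp add: \<phi>_def)
    qed
  qed (auto simp: \<phi>_def)
  have D: "(\<phi> has_real_derivative p s) (at s)" for s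
  proof (cases "s \<in> {c..d}")
    case True
    then have s: "s \<in> {a<..<b}" using cd by auto
    have "((\<lambda>x. integral {a..x} p) has_real_derivative p s) (at s within {a..b})"
      by (rule integral_has_real_derivative[OF pc]) (use s in auto)
    then have "((\<lambda>x. integral {a..x} p) has_real_derivative p s) (at s)"
      using s at_within_interior[of s "{a..b}"] by simp
    then show ?thesis
      by (rule has_field_derivative_transform_within_open[where S = "{a<..<b}"])
        (use s in \<open>auto simp: \<phi>_def\<close>)
  next
    case False
    have "((\<lambda>x. 0) has_real_derivative 0) (at s)" by simp
    then have "(\<phi> has_real_derivative 0) (at s)"
      by (rule has_field_derivative_transform_within_open[where S = "- {c..d}"])
        (use False zero in \<open>auto simp del: atLeastAtMost_iff\<close>)
    then show ?thesis using cd(4)[OF False] by simp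
  qed
  have "smooth_upto n \<phi>" for n
  proof -
    have "smooth_upto (Suc n) \<phi>"
      using D p by (intro smooth_upto_SucI[where g = p]) (auto simp: test_functions_altdef)
    then show ?thesis by (rule smooth_upto_mono) simp
  qed
  then have "\<phi> \<in> test_functions a b"
    using cd zero by (intro test_functionsI[where c = c and d = d]) auto
  moreover have "deriv \<phi> = p" using D by (intro ext DERIV_imp_deriv)
  ultimately show ?thesis by (rule that)
qed

text \<open>A test function with integral 0 is the derivative of a test function. Correcting \<psi>
  by a multiple of one fixed \<phi>0 makes its integral 0, and the correction accounts for the
  constant.\<close>

lemma du_Bois_Reymond:
  assumes "a < b" and h: "integrable (lebesgue_on {a..b}) h"
    and z: "\<And>\<phi>. \<phi> \<in> test_functions a b \<Longrightarrow> (\<integral>s. h s * deriv \<phi> s \<partial>lebesgue_on {a..b}) = 0"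
  obtains \<kappa> where "AE s in lebesgue_on {a..b}. h s = \<kappa>"
proof -
  \<comment> \<open>If every test function had integral 0, the fundamental lemma would make the
    constant 1 vanish almost everywhere.\<close>
  have "\<exists>\<phi>0\<in>test_functions a b. (\<integral>s. \<phi>0 s \<partial>lebesgue_on {a..b}) \<noteq> 0"
  proof (rule ccontr)
    assume "\<not> ?thesis"
    then have "AE s in lebesgue_on {a..b}. (1::real) = 0"
      by (intro fundamental_lemma_variations continuous_imp_integrable_real) auto
    with continuous_AE_eq_imp_eq[of a b "\<lambda>_. 1" "\<lambda>_. 0" a] assms(1) show False
      by simp
  qed
  then obtain \<phi>0 where \<phi>0: "\<phi>0 \<in> test_functions a b" "(\<integral>s. \<phi>0 s \<partial>lebesgue_on {a..b}) \<noteq> 0"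
    by blast
  define J where "J \<phi> = (\<integral>s. \<phi> s \<partial>lebesgue_on {a..b})" for \<phi> :: "real \<Rightarrow> real"
  \<comment> \<open>The only possible constant: if h = \<kappa> almost everywhere, testing against
    \<phi>0 gives this quotient.\<close>
  define \<kappa> where "\<kappa> = (\<integral>s. h s * \<phi>0 s \<partial>lebesgue_on {a..b}) / J \<phi>0"
  have int: "integrable (lebesgue_on {a..b}) \<phi>" "integrable (lebesgue_on {a..b}) (\<lambda>s. h s * \<phi> s)"
    if "\<phi> \<in> test_functions a b" for \<phi>
    using test_functions_continuous[OF that] h
    by (blast intro: continuous_imp_integrable_real integrable_mult_continuous)+
  have "AE s in lebesgue_on {a..b}. h s - \<kappa> = 0"
  proof (rule fundamental_lemma_variations)
    show "integrable (lebesgue_on {a..b}) (\<lambda>s. h s - \<kappa>)"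
      by (intro Bochner_Integration.integrable_diff h continuous_imp_integrable_real[OF continuous_on_const])
  next
    fix \<psi> assume \<psi>: "\<psi> \<in> test_functions a b"
    define p where "p s = \<psi> s + (- J \<psi> / J \<phi>0) * \<phi>0 s" for s
    have p: "p \<in> test_functions a b"
      unfolding p_def[abs_def] by (intro test_functions_cmult_add \<psi> \<phi>0 assms(1))
    have "(\<integral>s. p s \<partial>lebesgue_on {a..b}) = J \<psi> + (- J \<psi> / J \<phi>0) * J \<phi>0"
      unfolding p_def J_def using int(1)[OF \<psi>] int(1)[OF \<phi>0(1)]
      by (subst Bochner_Integration.integral_add) auto
    also have "\<dots> = 0" using \<phi>0(2) by (simp add: J_def)
    finally obtain \<phi> where \<phi>: "\<phi> \<in> test_functions a b" "deriv \<phi> = p"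
      using test_functions_primitive[OF p assms(1)] by metis
    have "0 = (\<integral>s. h s * p s \<partial>lebesgue_on {a..b})"
      using z[OF \<phi>(1)] \<phi>(2) by simp
    also have "\<dots> = (\<integral>s. h s * \<psi> s + (- J \<psi> / J \<phi>0) * (h s * \<phi>0 s) \<partial>lebesgue_on {a..b})"
      by (simp add: p_def algebra_simps)
    also have "\<dots> = (\<integral>s. h s * \<psi> s \<partial>lebesgue_on {a..b}) - \<kappa> * J \<psi>"
      using int(2)[OF \<psi>] int(2)[OF \<phi>0(1)]
      by (subst Bochner_Integration.integral_add) (auto simp: \<kappa>_def)
    also have "\<dots> = (\<integral>s. h s * \<psi> s - \<kappa> * \<psi> s \<partial>lebesgue_on {a..b})"
      using int(1)[OF \<psi>] int(2)[OF \<psi>]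
      by (subst Bochner_Integration.integral_diff) (auto simp: J_def)
    finally show "(\<integral>s. (h s - \<kappa>) * \<psi> s \<partial>lebesgue_on {a..b}) = 0"
      by (simp add: algebra_simps)
  qed
  then show ?thesis by (intro that[of \<kappa>]) auto
qed

section \<open>Weak derivatives of scalar functions\<close>

definition scalar_weak_deriv ::
  "real \<Rightarrow> real \<Rightarrow> nat \<Rightarrow> (real \<Rightarrow> real) \<Rightarrow> (real \<Rightarrow> real) \<Rightarrow> bool" where
  "scalar_weak_deriv a b k f g \<longleftrightarrow> (\<forall>\<phi>\<in>test_functions a b.
     (\<integral>s. f s * (deriv ^^ k) \<phi> s \<partial>lebesgue_on {a..b}) =
     (-1) ^ k * (\<integral>s. g s * \<phi> s \<partial>lebesgue_on {a..b}))"

lemma weak_deriv_iff_scalar: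
  "weak_deriv a b m k f g \<longleftrightarrow> (\<forall>i<m. scalar_weak_deriv a b k (\<lambda>s. f s $ i) (\<lambda>s. g s $ i))"
  unfolding weak_deriv_def scalar_weak_deriv_def by blast

text \<open>The boundary terms of the integration by parts vanish with \<phi>, and c pairs with
  \<phi>' to c (\<phi> b - \<phi> a) = 0.\<close>

lemma scalar_weak_deriv_primitive:
  assumes "a < b" and g: "integrable (lebesgue_on {a..b}) g"
  shows "scalar_weak_deriv a b 1 (\<lambda>s. c + (\<integral>t. g t \<partial>lebesgue_on {a..s})) g"
  unfolding scalar_weak_deriv_def
proof
  fix \<phi> assume \<phi>: "\<phi> \<in> test_functions a b"
  note \<phi>' = test_functions_deriv[OF \<phi>]
  let ?F = "\<lambda>s. \<integral>t. g t \<partial>lebesgue_on {a..s}"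
  have ends: "\<phi> a = 0" "\<phi> b = 0" using test_functions_eq_0[OF \<phi>] by auto
  have "(deriv \<phi> has_integral \<phi> b - \<phi> a) {a..b}"
    using assms(1) test_functions_DERIV[OF \<phi>]
    by (intro fundamental_theorem_of_calculus)
      (auto intro: DERIV_subset simp flip: has_real_derivative_iff_has_vector_derivative)
  moreover have i: "integrable (lebesgue_on {a..b}) (deriv \<phi>)"
    by (intro continuous_imp_integrable_real test_functions_continuous[OF \<phi>'])
  ultimately have 0: "(\<integral>s. deriv \<phi> s \<partial>lebesgue_on {a..b}) = 0"
    using ends by (simp add: LINT_lebesgue_on_eq_integral integral_unique)
  have "(\<integral>s. g s * \<phi> s \<partial>lebesgue_on {a..b})
      = - (\<integral>s. ?F s * deriv \<phi> s \<partial>lebesgue_on {a..b})"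
    using assms(1) ends
    by (subst integration_by_parts_primitive[OF g _ test_functions_DERIV[OF \<phi>]])
      (auto intro: test_functions_continuous[OF \<phi>'])
  moreover have "(\<integral>s. (c + ?F s) * deriv \<phi> s \<partial>lebesgue_on {a..b})
      = c * (\<integral>s. deriv \<phi> s \<partial>lebesgue_on {a..b}) + (\<integral>s. ?F s * deriv \<phi> s \<partial>lebesgue_on {a..b})"
    unfolding distrib_right using i
    by (subst Bochner_Integration.integral_add)
      (auto intro!: continuous_imp_integrable_real[OF continuous_on_mult] continuous_on_primitive g
        test_functions_continuous[OF \<phi>'])
  ultimately show "(\<integral>s. (c + ?F s) * (deriv ^^ 1) \<phi> s \<partial>lebesgue_on {a..b})
      = (- 1) ^ 1 * (\<integral>s. g s * \<phi> s \<partial>lebesgue_on {a..b})"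
    using 0 by simp
qed

text \<open>Subtracting the primitive of g leaves a function with weak derivative 0, which is
  constant by du Bois-Reymond.\<close>

lemma scalar_weak_deriv_1_imp_primitive:
  assumes "a < b" and f: "integrable (lebesgue_on {a..b}) f" and g: "integrable (lebesgue_on {a..b}) g"
    and w: "scalar_weak_deriv a b 1 f g"
  obtains c where "AE s in lebesgue_on {a..b}. f s = c + (\<integral>t. g t \<partial>lebesgue_on {a..s})"
proof -
  let ?F = "\<lambda>s. \<integral>t. g t \<partial>lebesgue_on {a..s}"
  have F: "integrable (lebesgue_on {a..b}) ?F"
    by (intro continuous_imp_integrable_real continuous_on_primitive g)
  have "(\<integral>s. (f s - ?F s) * deriv \<phi> s \<partial>lebesgue_on {a..b}) = 0"
    if \<phi>: "\<phi> \<in> test_functions a b" for \<phi>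
  proof -
    have "(\<integral>s. (f s - ?F s) * deriv \<phi> s \<partial>lebesgue_on {a..b})
      = (\<integral>s. f s * deriv \<phi> s \<partial>lebesgue_on {a..b}) - (\<integral>s. ?F s * deriv \<phi> s \<partial>lebesgue_on {a..b})"
      unfolding left_diff_distrib
      by (subst Bochner_Integration.integral_diff)
        (auto intro!: integrable_mult_continuous f F test_functions_continuous[OF test_functions_deriv[OF \<phi>]])
    then show ?thesis
      using w scalar_weak_deriv_primitive[OF assms(1) g, of 0] \<phi>
      by (auto simp: scalar_weak_deriv_def)
  qed
  then obtain c where "AE s in lebesgue_on {a..b}. f s - ?F s = c"
    using du_Bois_Reymond[OF assms(1) Bochner_Integration.integrable_diff[OF f F]] by blast
  then have "AE s in lebesgue_on {a..b}. f s = c + ?F s"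
    by eventually_elim simp
  then show ?thesis by (rule that)
qed

lemma scalar_weak_deriv_unique:
  assumes "integrable (lebesgue_on {a..b}) g" "integrable (lebesgue_on {a..b}) h"
    and "scalar_weak_deriv a b k f g" "scalar_weak_deriv a b k f h"
  shows "AE s in lebesgue_on {a..b}. g s = h s"
proof -
  have "AE s in lebesgue_on {a..b}. g s - h s = 0"
  proof (rule fundamental_lemma_variations)
    fix \<phi> assume \<phi>: "\<phi> \<in> test_functions a b"
    have "(\<integral>s. g s * \<phi> s \<partial>lebesgue_on {a..b}) = (\<integral>s. h s * \<phi> s \<partial>lebesgue_on {a..b})"
      using bspec[OF assms(3)[unfolded scalar_weak_deriv_def] \<phi>]
        bspec[OF assms(4)[unfolded scalar_weak_deriv_def] \<phi>] by simp
    then show "(\<integral>s. (g s - h s) * \<phi> s \<partial>lebesgue_on {a..b}) = 0"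
      unfolding left_diff_distrib
      by (subst Bochner_Integration.integral_diff)
        (auto intro!: integrable_mult_continuous assms test_functions_continuous[OF \<phi>])
  qed (use assms in auto)
  then show ?thesis by eventually_elim simp
qed

text \<open>Derivatives of test functions are test functions, so the k-th derivative of \<phi> may
  itself be used for testing. Both directions serve: one composes derivatives, the other shows that
  a second derivative of f is a first derivative of any first derivative of f.\<close>

lemma scalar_weak_deriv_comp:
  assumes "scalar_weak_deriv a b j f g"
  shows "scalar_weak_deriv a b k g h \<longleftrightarrow> scalar_weak_deriv a b (j + k) f h"
proof -
  have test: "(deriv ^^ k) \<phi> \<in> test_functions a b" if "\<phi> \<in> test_functions a b" for \<phi>
    using that by (induction k) (auto intro: test_functions_deriv)
  have "(\<integral>s. f s * (deriv ^^ (j + k)) \<phi> s \<partial>lebesgue_on {a..b}) =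
      (-1) ^ j * (\<integral>s. g s * (deriv ^^ k) \<phi> s \<partial>lebesgue_on {a..b})"
    if "\<phi> \<in> test_functions a b" for \<phi>
    using assms test[OF that] by (simp add: scalar_weak_deriv_def funpow_add)
  then show ?thesis
    by (simp add: scalar_weak_deriv_def power_add mult.assoc)
qed

section \<open>Block matrices and integrals of vector-valued functions\<close>

lemma dim_append_cols [simp]:
  "dim_row (A @\<^sub>c B) = dim_row A" "dim_col (A @\<^sub>c B) = dim_col A + dim_col B"
  by (simp_all add: append_cols_def)

lemma dim_append_rows [simp]:
  "dim_row (A @\<^sub>r B) = dim_row A + dim_row B" "dim_col (A @\<^sub>r B) = dim_col A"
  by (simp_all add: append_rows_def)

text \<open>\<open>@\<^sub>c\<close> is a four-block matrix whose lower blocks have no rows, so the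
  four-block product rule applies and the lower half of the result is the empty vector.\<close>

lemma append_cols_mult_vec:
  fixes A B :: "'a :: semiring_0 mat"
  assumes "dim_row B = dim_row A" "dim_vec u = dim_col A" "dim_vec w = dim_col B"
  shows "(A @\<^sub>c B) *\<^sub>v (u @\<^sub>v w) = A *\<^sub>v u + B *\<^sub>v w"
proof -
  have c: "A \<in> carrier_mat (dim_row A) (dim_col A)" "B \<in> carrier_mat (dim_row A) (dim_col B)"
    "u \<in> carrier_vec (dim_col A)" "w \<in> carrier_vec (dim_col B)"
    using assms by (auto intro: carrier_vecI)
  have "(A @\<^sub>c B) *\<^sub>v (u @\<^sub>v w)
    = (A *\<^sub>v u + B *\<^sub>v w) @\<^sub>v (0\<^sub>m 0 (dim_col A) *\<^sub>v u + 0\<^sub>m 0 (dim_col B) *\<^sub>v w)"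
    unfolding append_cols_def
    by (rule four_block_mat_mult_vec[OF c(1,2) zero_carrier_mat zero_carrier_mat c(3,4)])
  also have "\<dots> = A *\<^sub>v u + B *\<^sub>v w"
    by (rule eq_vecI) simp_all
  finally show ?thesis .
qed

lemma append_rows_mult_vec:
  fixes A B :: "'a :: comm_semiring_1 mat"
  assumes "dim_col A = dim_vec v" "dim_col B = dim_vec v"
  shows "(A @\<^sub>r B) *\<^sub>v v = (A *\<^sub>v v) @\<^sub>v (B *\<^sub>v v)"
  using assms by (intro mat_mult_append[of _ "dim_row A" "dim_vec v" _ "dim_row B"]) (auto intro: carrier_matI)

lemma zero_mult_mat_vec: "dim_vec v = m \<Longrightarrow> 0\<^sub>m k m *\<^sub>v v = 0\<^sub>v k"
  by (intro eq_vecI) (auto simp: scalar_prod_def)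

lemma one_mult_mat_vec_dim:
  fixes v :: "'a :: semiring_1 vec"
  shows "dim_vec v = m \<Longrightarrow> 1\<^sub>m m *\<^sub>v v = v"
  by (intro one_mult_mat_vec carrier_vecI)

lemma smult_one_mult_mat_vec:
  fixes v :: "'a :: comm_semiring_1 vec"
  shows "dim_vec v = m \<Longrightarrow> (c \<cdot>\<^sub>m 1\<^sub>m m) *\<^sub>v v = c \<cdot>\<^sub>v v"
  by (intro eq_vecI) (auto simp: scalar_prod_left_unit[OF carrier_vecI])

lemma mult_uminus_mat_vec:
  fixes A :: "'a :: ring mat"
  shows "A \<in> carrier_mat k m \<Longrightarrow> v \<in> carrier_vec m \<Longrightarrow> A *\<^sub>v (- v) = - (A *\<^sub>v v)"
  by (intro eq_vecI) auto

lemma carrier_vec_appendE: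
  assumes "v \<in> carrier_vec (m + k)"
  obtains u w where "u \<in> carrier_vec m" "w \<in> carrier_vec k" "v = u @\<^sub>v w"
  using that[OF vec_first_carrier vec_last_carrier vec_first_last_append[OF assms, symmetric]] .

lemmas block_mult_simps = append_cols_mult_vec append_rows_mult_vec zero_mult_mat_vec
  one_mult_mat_vec_dim smult_one_mult_mat_vec

lemma T_mat_mult_vec:
  assumes "u \<in> carrier_vec n1" "v \<in> carrier_vec n2" "w \<in> carrier_vec n2"
  shows "T_mat a b n1 n2 *\<^sub>v (u @\<^sub>v v @\<^sub>v w)
    = u @\<^sub>v u @\<^sub>v v @\<^sub>v (v + (b - a) \<cdot>\<^sub>v w) @\<^sub>v w @\<^sub>v w"
  using assms by (simp add: T_mat_def block_mult_simps carrier_vecD)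

lemma K_mat_mult_vec:
  assumes "u \<in> carrier_vec n1" "v \<in> carrier_vec n2" "w \<in> carrier_vec n2"
  shows "K_mat a n0 n1 n2 s *\<^sub>v (u @\<^sub>v v @\<^sub>v w)
    = 0\<^sub>v n0 @\<^sub>v u @\<^sub>v (v + (s - a) \<cdot>\<^sub>v w)"
  using assms by (simp add: K_mat_def block_mult_simps carrier_vecD)

lemma Q_mat_mult_vec:
  assumes "u \<in> carrier_vec n0" "v \<in> carrier_vec n1" "w \<in> carrier_vec n2"
  shows "Q_mat b n0 n1 n2 s \<theta> *\<^sub>v (u @\<^sub>v v @\<^sub>v w)
    = 0\<^sub>v n1 @\<^sub>v v @\<^sub>v 0\<^sub>v n2 @\<^sub>v ((b - \<theta>) \<cdot>\<^sub>v w) @\<^sub>v 0\<^sub>v n2 @\<^sub>v w"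
  using assms by (simp add: Q_mat_def block_mult_simps carrier_vecD)

lemma G0_mult_vec:
  assumes "u \<in> carrier_vec n0" "v \<in> carrier_vec n1" "w \<in> carrier_vec n2"
  shows "G0 n0 n1 n2 s *\<^sub>v (u @\<^sub>v v @\<^sub>v w) = u @\<^sub>v 0\<^sub>v n1 @\<^sub>v 0\<^sub>v n2"
  using assms by (simp add: G0_def block_mult_simps carrier_vecD)

text \<open>The summand of \<open>G1\<close> beside \<open>G2\<close>: its kernels 1 and s -
  \<theta> produce the single primitive in the n1 block and the double primitive in the n2
  block.\<close>

definition J_mat :: "nat \<Rightarrow> nat \<Rightarrow> nat \<Rightarrow> real \<Rightarrow> real \<Rightarrow> real mat" where
  "J_mat n0 n1 n2 s \<theta> =
     (0\<^sub>m n0 n0 @\<^sub>c 0\<^sub>m n0 n1 @\<^sub>c 0\<^sub>m n0 n2) @\<^sub>r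
     (0\<^sub>m n1 n0 @\<^sub>c 1\<^sub>m n1    @\<^sub>c 0\<^sub>m n1 n2) @\<^sub>r
     (0\<^sub>m n2 n0 @\<^sub>c 0\<^sub>m n2 n1 @\<^sub>c (s - \<theta>) \<cdot>\<^sub>m 1\<^sub>m n2)"

lemma J_mat_mult_vec:
  assumes "u \<in> carrier_vec n0" "v \<in> carrier_vec n1" "w \<in> carrier_vec n2"
  shows "J_mat n0 n1 n2 s \<theta> *\<^sub>v (u @\<^sub>v v @\<^sub>v w) = 0\<^sub>v n0 @\<^sub>v v @\<^sub>v ((s - \<theta>) \<cdot>\<^sub>v w)"
  using assms by (simp add: J_mat_def block_mult_simps carrier_vecD)

lemma block_mat_carriers [simp]:
  "T_mat a b n1 n2 \<in> carrier_mat (2 * n1 + 4 * n2) (n1 + 2 * n2)"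
  "K_mat a n0 n1 n2 s \<in> carrier_mat (n0 + n1 + n2) (n1 + 2 * n2)"
  "Q_mat b n0 n1 n2 s \<theta> \<in> carrier_mat (2 * n1 + 4 * n2) (n0 + n1 + n2)"
  "G0 n0 n1 n2 s \<in> carrier_mat (n0 + n1 + n2) (n0 + n1 + n2)"
  "J_mat n0 n1 n2 s \<theta> \<in> carrier_mat (n0 + n1 + n2) (n0 + n1 + n2)"
  by (auto simp: T_mat_def K_mat_def Q_mat_def G0_def J_mat_def intro!: carrier_matI)

section \<open>Componentwise integration of vector-valued functions\<close>

definition vec_integrable :: "nat \<Rightarrow> real set \<Rightarrow> (real \<Rightarrow> real vec) \<Rightarrow> bool" where
  "vec_integrable m S f \<longleftrightarrow> (\<forall>s\<in>S. f s \<in> carrier_vec m) \<and>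
     (\<forall>i<m. integrable (lebesgue_on S) (\<lambda>s. f s $ i))"

lemma vec_integral_carrier [simp]: "vec_integral m S f \<in> carrier_vec m"
  by (simp add: vec_integral_def)

lemma vec_integral_dim [simp]: "dim_vec (vec_integral m S f) = m"
  by (simp add: vec_integral_def)

lemma vec_integral_cong:
  "(\<And>s. s \<in> S \<Longrightarrow> f s = g s) \<Longrightarrow> vec_integral m S f = vec_integral m S g"
  unfolding vec_integral_def
  by (intro arg_cong[where f = "vec m"] ext Bochner_Integration.integral_cong) auto

lemma vec_integral_zero [simp]: "vec_integral m S (\<lambda>_. 0\<^sub>v m) = 0\<^sub>v m"
  by (intro eq_vecI) (auto simp: vec_integral_def)

lemma
  assumes A: "A \<in> carrier_mat k m" and f: "vec_integrable m S f"
  shows vec_integrable_mult_mat: "vec_integrable k S (\<lambda>s. A *\<^sub>v f s)"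
    and vec_integral_mult_mat: "vec_integral k S (\<lambda>s. A *\<^sub>v f s) = A *\<^sub>v vec_integral m S f"
proof -
  have eq: "(A *\<^sub>v f s) $ i = (\<Sum>j<m. A $$ (i, j) * f s $ j)" if "s \<in> S" "i < k" for s i
    using that A f by (auto simp: vec_integrable_def scalar_prod_def atLeast0LessThan
        dest!: bspec[where x = s] intro!: sum.cong)
  have int: "integrable (lebesgue_on S) (\<lambda>s. \<Sum>j<m. A $$ (i, j) * f s $ j)" for i
    using f by (intro Bochner_Integration.integrable_sum integrable_mult_right) (auto simp: vec_integrable_def)
  have "integrable (lebesgue_on S) (\<lambda>s. (A *\<^sub>v f s) $ i)" if "i < k" for i
    using int[of i] by (rule Bochner_Integration.integrable_cong[THEN iffD1, rotated -1])
      (use that eq in auto)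
  then show "vec_integrable k S (\<lambda>s. A *\<^sub>v f s)"
    using A f by (auto simp: vec_integrable_def)
  show "vec_integral k S (\<lambda>s. A *\<^sub>v f s) = A *\<^sub>v vec_integral m S f"
  proof (rule eq_vecI)
    fix i assume "i < dim_vec (A *\<^sub>v vec_integral m S f)"
    then have i: "i < k" using A by simp
    have "vec_integral k S (\<lambda>s. A *\<^sub>v f s) $ i = (\<integral>s. (A *\<^sub>v f s) $ i \<partial>lebesgue_on S)"
      using i by (simp add: vec_integral_def)
    also have "\<dots> = (\<integral>s. (\<Sum>j<m. A $$ (i, j) * f s $ j) \<partial>lebesgue_on S)"
      using i eq by (intro Bochner_Integration.integral_cong) auto
    also have "\<dots> = (\<Sum>j<m. A $$ (i, j) * (\<integral>s. f s $ j \<partial>lebesgue_on S))"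
      using f by (subst Bochner_Integration.integral_sum) (auto simp: vec_integrable_def)
    also have "\<dots> = (A *\<^sub>v vec_integral m S f) $ i"
      using i A by (auto simp: vec_integral_def scalar_prod_def atLeast0LessThan intro!: sum.cong)
    finally show "vec_integral k S (\<lambda>s. A *\<^sub>v f s) $ i = (A *\<^sub>v vec_integral m S f) $ i" .
  qed (use A in auto)
qed

lemma vec_integral_add:
  assumes f: "vec_integrable m S f" and g: "vec_integrable m S g"
  shows "vec_integral m S (\<lambda>s. f s + g s) = vec_integral m S f + vec_integral m S g"
proof (rule eq_vecI)
  fix i assume "i < dim_vec (vec_integral m S f + vec_integral m S g)"
  then have i: "i < m" by simp
  have "(f s + g s) $ i = f s $ i + g s $ i" if "s \<in> S" for s
    using that i f g by (auto simp: vec_integrable_def)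
  then have "vec_integral m S (\<lambda>s. f s + g s) $ i = (\<integral>s. f s $ i + g s $ i \<partial>lebesgue_on S)"
    using i by (auto simp: vec_integral_def intro!: Bochner_Integration.integral_cong)
  also have "\<dots> = (vec_integral m S f + vec_integral m S g) $ i"
    using i f g by (auto simp: vec_integral_def vec_integrable_def)
  finally show "vec_integral m S (\<lambda>s. f s + g s) $ i = (vec_integral m S f + vec_integral m S g) $ i" .
qed simp

lemma vec_integral_append:
  assumes "\<And>s. s \<in> S \<Longrightarrow> f s \<in> carrier_vec m" "\<And>s. s \<in> S \<Longrightarrow> g s \<in> carrier_vec k"
  shows "vec_integral (m + k) S (\<lambda>s. f s @\<^sub>v g s) = vec_integral m S f @\<^sub>v vec_integral k S g"
  by (intro eq_vecI)
    (auto simp: vec_integral_def carrier_vecD[OF assms(1)] carrier_vecD[OF assms(2)]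
      intro!: Bochner_Integration.integral_cong)

lemma vec_integrable_append:
  assumes f: "vec_integrable m S f" and g: "vec_integrable k S g"
  shows "vec_integrable (m + k) S (\<lambda>s. f s @\<^sub>v g s)"
  unfolding vec_integrable_def
proof (intro conjI allI impI ballI)
  fix i assume i: "i < m + k"
  have "integrable (lebesgue_on S) (\<lambda>s. if i < m then f s $ i else g s $ (i - m))"
    using f g i by (cases "i < m") (auto simp: vec_integrable_def)
  then show "integrable (lebesgue_on S) (\<lambda>s. (f s @\<^sub>v g s) $ i)"
    by (rule Bochner_Integration.integrable_cong[THEN iffD1, rotated -1])
      (use f g i in \<open>auto simp: vec_integrable_def dest!: bspec carrier_vecD\<close>)
qed (use f g in \<open>auto simp: vec_integrable_def\<close>)

lemma vec_integrable_zero [simp]: "vec_integrable m S (\<lambda>_. 0\<^sub>v m)"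
  by (simp add: vec_integrable_def)

lemma vec_integrable_smult_continuous:
  assumes f: "vec_integrable m {a..b} f" and "continuous_on {a..b} \<psi>"
  shows "vec_integrable m {a..b} (\<lambda>s. \<psi> s \<cdot>\<^sub>v f s)"
  unfolding vec_integrable_def
proof (intro conjI allI impI ballI)
  fix i assume i: "i < m"
  have "integrable (lebesgue_on {a..b}) (\<lambda>s. f s $ i * \<psi> s)"
    using assms i by (intro integrable_mult_continuous) (auto simp: vec_integrable_def)
  then show "integrable (lebesgue_on {a..b}) (\<lambda>s. (\<psi> s \<cdot>\<^sub>v f s) $ i)"
    by (rule Bochner_Integration.integrable_cong[THEN iffD1, rotated -1])
      (use f i in \<open>auto simp: vec_integrable_def dest!: bspec carrier_vecD\<close>)
qed (use f in \<open>auto simp: vec_integrable_def\<close>)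

lemma vec_integrable_subinterval:
  "vec_integrable m {a..b} f \<Longrightarrow> a \<le> c \<Longrightarrow> d \<le> b \<Longrightarrow> vec_integrable m {c..d} f"
  by (auto simp: vec_integrable_def intro: integrable_lebesgue_on_subinterval)

lemma vec_integral_split:
  assumes "vec_integrable m {a..b} f" "s \<in> {a..b}"
  shows "vec_integral m {a..s} f + vec_integral m {s..b} f = vec_integral m {a..b} f"
  using assms by (intro eq_vecI) (auto simp: vec_integral_def vec_integrable_def LINT_lebesgue_on_split)

section \<open>The boundary conditions and the operator\<close>

lemma append_carrier_vec_triple:
  "u \<in> carrier_vec n1 \<Longrightarrow> v \<in> carrier_vec n2 \<Longrightarrow> w \<in> carrier_vec n2 \<Longrightarrow>
    u @\<^sub>v v @\<^sub>v w \<in> carrier_vec (n1 + 2 * n2)"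
  by (auto intro!: carrier_vecI simp: carrier_vecD)

locale boundary_system =
  fixes a b :: real and n0 n1 n2 :: nat and B :: "real mat"
  assumes ab: "a < b"
    and B: "B \<in> carrier_mat (n1 + 2 * n2) (2 * n1 + 4 * n2)"
    and BT: "invertible_mat (B * T_mat a b n1 n2)"
begin

definition BT_inv :: "real mat" where
  "BT_inv = the (mat_inverse (B * T_mat a b n1 n2))"

text \<open>\<open>mat_inverse\<close> returns an option: invertibility is first turned into
  membership in the units of the matrix ring, after which \<open>the\<close> yields a genuine
  two-sided inverse.\<close>

lemma BT_inv:
  "BT_inv \<in> carrier_mat (n1 + 2 * n2) (n1 + 2 * n2)"
  "BT_inv * (B * T_mat a b n1 n2) = 1\<^sub>m (n1 + 2 * n2)"
  "(B * T_mat a b n1 n2) * BT_inv = 1\<^sub>m (n1 + 2 * n2)"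
proof -
  let ?n = "n1 + 2 * n2" and ?A = "B * T_mat a b n1 n2"
  have A: "?A \<in> carrier_mat ?n ?n" using B by (rule mult_carrier_mat) simp
  obtain C where C: "?A * C = 1\<^sub>m (dim_row ?A)" "C * ?A = 1\<^sub>m (dim_row C)"
    using BT unfolding invertible_mat_def inverts_mat_def by metis
  \<comment> \<open>\<open>invertible_mat\<close> does not fix the shape of C; comparing column
    counts in the two identities does.\<close>
  have "dim_row C = ?n" "dim_col C = ?n"
    using arg_cong[OF C(2), of dim_col] arg_cong[OF C(1), of dim_col] carrier_matD[OF A] by auto
  then have "?A \<in> Units (ring_mat TYPE(real) ?n ())"
    using A C by (auto simp: Units_def ring_mat_def intro!: bexI[of _ C])
  then obtain D where "mat_inverse ?A = Some D"
    using mat_inverse(1)[OF A, where b = "()"] by (cases "mat_inverse ?A") auto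
  with mat_inverse(2)[OF A this] show "BT_inv \<in> carrier_mat ?n ?n" "BT_inv * ?A = 1\<^sub>m ?n" "?A * BT_inv = 1\<^sub>m ?n"
    by (simp_all add: BT_inv_def)
qed

text \<open>This is the integral of Q xh over [a,b]. The three blocks belonging to the endpoint a
  are 0 because every primitive is taken from a.\<close>

definition boundary_source :: "(real \<Rightarrow> real vec) \<Rightarrow> (real \<Rightarrow> real vec) \<Rightarrow> real vec" where
  "boundary_source x1 x2 = 0\<^sub>v n1 @\<^sub>v vec_integral n1 {a..b} x1 @\<^sub>v 0\<^sub>v n2
     @\<^sub>v vec_integral n2 {a..b} (\<lambda>\<theta>. (b - \<theta>) \<cdot>\<^sub>v x2 \<theta>) @\<^sub>v 0\<^sub>v n2 @\<^sub>v vec_integral n2 {a..b} x2"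

lemma boundary_source_carrier [simp]: "boundary_source x1 x2 \<in> carrier_vec (2 * n1 + 4 * n2)"
  by (rule carrier_vecI) (simp add: boundary_source_def)

text \<open>The values \<open>(x1 a, x2 a, \<partial>\<^sub>s x2 a)\<close> forced by the boundary conditions.\<close>
definition core_values :: "(real \<Rightarrow> real vec) \<Rightarrow> (real \<Rightarrow> real vec) \<Rightarrow> real vec" where
  "core_values x1 x2 = - (BT_inv *\<^sub>v (B *\<^sub>v boundary_source x1 x2))"

lemma core_values_carrier [simp]: "core_values x1 x2 \<in> carrier_vec (n1 + 2 * n2)"
  using BT_inv(1) B by (simp add: core_values_def)

text \<open>By linearity the condition reads (BT) c = -B q. The left inverse gives uniqueness of c,
  which identifies the values at a of a given x; the right inverse shows that this c is a solution,
  which puts the constructed function into X.\<close>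

lemma boundary_condition_iff:
  assumes c: "c \<in> carrier_vec (n1 + 2 * n2)"
  shows "B *\<^sub>v (T_mat a b n1 n2 *\<^sub>v c + boundary_source x1 x2) = 0\<^sub>v (n1 + 2 * n2)
    \<longleftrightarrow> c = core_values x1 x2"
proof -
  let ?n = "n1 + 2 * n2" and ?A = "B * T_mat a b n1 n2" and ?r = "B *\<^sub>v boundary_source x1 x2"
  have A: "?A \<in> carrier_mat ?n ?n" using B by (rule mult_carrier_mat) simp
  have r: "?r \<in> carrier_vec ?n" using B by simp
  have Ac: "?A *\<^sub>v c = B *\<^sub>v (T_mat a b n1 n2 *\<^sub>v c)"
    using B block_mat_carriers(1) c by (rule assoc_mult_mat_vec)
  have eq: "B *\<^sub>v (T_mat a b n1 n2 *\<^sub>v c + boundary_source x1 x2) = ?A *\<^sub>v c + ?r"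
    unfolding Ac using B mult_mat_vec_carrier[OF block_mat_carriers(1) c] boundary_source_carrier
    by (rule mult_add_distrib_mat_vec)
  have inv1: "BT_inv *\<^sub>v (?A *\<^sub>v c) = c"
    using assoc_mult_mat_vec[OF BT_inv(1) A c] BT_inv(2) c by simp
  have inv2: "?A *\<^sub>v (BT_inv *\<^sub>v ?r) = ?r"
    using assoc_mult_mat_vec[OF A BT_inv(1) r] BT_inv(3) r by simp
  have Acc: "?A *\<^sub>v c \<in> carrier_vec ?n" using A c by (rule mult_mat_vec_carrier)
  show ?thesis
  proof
    assume "B *\<^sub>v (T_mat a b n1 n2 *\<^sub>v c + boundary_source x1 x2) = 0\<^sub>v ?n"
    then have 0: "?A *\<^sub>v c + ?r = 0\<^sub>v ?n" using eq by simp
    have "?A *\<^sub>v c = - ?r"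
    proof (rule eq_vecI)
      fix i assume "i < dim_vec (- ?r)"
      then have i: "i < ?n" using carrier_vecD[OF r] by (simp only: index_uminus_vec)
      have "(?A *\<^sub>v c + ?r) $ i = 0" using 0 i by simp
      then show "(?A *\<^sub>v c) $ i = (- ?r) $ i"
        using i carrier_vecD[OF r] carrier_vecD[OF Acc] by simp
    qed (simp add: carrier_vecD[OF r] carrier_vecD[OF Acc])
    then have "BT_inv *\<^sub>v (?A *\<^sub>v c) = - (BT_inv *\<^sub>v ?r)"
      using mult_uminus_mat_vec[OF BT_inv(1) r] by simp
    then show "c = core_values x1 x2"
      by (simp only: inv1 core_values_def)
  next
    assume "c = core_values x1 x2"
    then have "?A *\<^sub>v c = - ?r"
      using mult_uminus_mat_vec[OF A mult_mat_vec_carrier[OF BT_inv(1) r]] inv2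
      by (simp only: core_values_def)
    then show "B *\<^sub>v (T_mat a b n1 n2 *\<^sub>v c + boundary_source x1 x2) = 0\<^sub>v ?n"
      using r by (simp add: eq)
  qed
qed

text \<open>The vectors u, v, w are left open as the blocks of \<open>core_values\<close>, so that
  the formula serves twice: for a given x they are its values at a, and for a given xh they define
  the values of the result.\<close>

lemma T_op_eq:
  assumes xh: "\<And>s. s \<in> {a..b} \<Longrightarrow> xh s = x0 s @\<^sub>v x1 s @\<^sub>v x2 s"
    and x0: "\<And>s. s \<in> {a..b} \<Longrightarrow> x0 s \<in> carrier_vec n0"
    and x1: "vec_integrable n1 {a..b} x1" and x2: "vec_integrable n2 {a..b} x2"
    and uvw: "u \<in> carrier_vec n1" "v \<in> carrier_vec n2" "w \<in> carrier_vec n2"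
    and core: "core_values x1 x2 = u @\<^sub>v v @\<^sub>v w"
    and s: "s \<in> {a..b}"
  shows "T_op a b n0 n1 n2 B xh s = x0 s @\<^sub>v (u + vec_integral n1 {a..s} x1)
    @\<^sub>v (v + (s - a) \<cdot>\<^sub>v w + vec_integral n2 {a..s} (\<lambda>\<theta>. (s - \<theta>) \<cdot>\<^sub>v x2 \<theta>))"
proof -
  let ?n = "n0 + n1 + n2" and ?N = "2 * n1 + 4 * n2" and ?m = "n1 + 2 * n2"
  let ?K = "K_mat a n0 n1 n2 s"
  \<comment> \<open>\<open>M\<close> gathers the factors of \<open>G2\<close> that do not depend on
    \<theta>, so that it can be taken out of the integrals.\<close>
  define M where "M = - (?K * BT_inv * B)"
  define Qx where "Qx \<theta> = 0\<^sub>v n1 @\<^sub>v x1 \<theta> @\<^sub>v 0\<^sub>v n2 @\<^sub>v ((b - \<theta>) \<cdot>\<^sub>v x2 \<theta>) @\<^sub>v 0\<^sub>v n2 @\<^sub>v x2 \<theta>" for \<theta>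
  define Jx where "Jx \<theta> = 0\<^sub>v n0 @\<^sub>v x1 \<theta> @\<^sub>v ((s - \<theta>) \<cdot>\<^sub>v x2 \<theta>)" for \<theta>
  have x1c: "x1 \<theta> \<in> carrier_vec n1" and x2c: "x2 \<theta> \<in> carrier_vec n2" if "\<theta> \<in> {a..b}" for \<theta>
    using that x1 x2 by (auto simp: vec_integrable_def)
  have KB: "?K * BT_inv * B \<in> carrier_mat ?n ?N"
    by (intro mult_carrier_mat[OF mult_carrier_mat[OF block_mat_carriers(2) BT_inv(1)] B])
  then have M: "M \<in> carrier_mat ?n ?N" by (simp add: M_def)
  have xhc: "xh \<theta> \<in> carrier_vec ?n" if "\<theta> \<in> {a..b}" for \<theta>
    using x0[OF that] x1c[OF that] x2c[OF that] xh[OF that]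
    by (intro carrier_vecI) (simp add: carrier_vecD)
  have G2x: "G2 a b n0 n1 n2 B s \<theta> *\<^sub>v xh \<theta> = M *\<^sub>v Qx \<theta>" if "\<theta> \<in> {a..b}" for \<theta>
  proof -
    have "G2 a b n0 n1 n2 B s \<theta> = M * Q_mat b n0 n1 n2 s \<theta>"
      unfolding G2_def M_def BT_inv_def[symmetric]
      using carrier_matD(2)[OF KB] carrier_matD(1)[OF block_mat_carriers(3)]
      by (intro uminus_mult_left_mat[symmetric]) (simp only:)
    then have "G2 a b n0 n1 n2 B s \<theta> *\<^sub>v xh \<theta> = M *\<^sub>v (Q_mat b n0 n1 n2 s \<theta> *\<^sub>v xh \<theta>)"
      using assoc_mult_mat_vec[OF M block_mat_carriers(3) xhc[OF that]] by simp
    also have "Q_mat b n0 n1 n2 s \<theta> *\<^sub>v xh \<theta> = Qx \<theta>"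
      unfolding xh[OF that] Qx_def using x0[OF that] x1c[OF that] x2c[OF that]
      by (rule Q_mat_mult_vec)
    finally show ?thesis .
  qed
  have G2c: "G2 a b n0 n1 n2 B s \<theta> \<in> carrier_mat ?n ?n" for \<theta>
    using mult_carrier_mat[OF KB block_mat_carriers(3)] by (simp add: G2_def BT_inv_def)
  have G1x: "G1 a b n0 n1 n2 B s \<theta> *\<^sub>v xh \<theta> = Jx \<theta> + M *\<^sub>v Qx \<theta>" if "\<theta> \<in> {a..b}" for \<theta>
  proof -
    have "G1 a b n0 n1 n2 B s \<theta> = J_mat n0 n1 n2 s \<theta> + G2 a b n0 n1 n2 B s \<theta>"
      by (simp add: G1_def J_mat_def)
    then have "G1 a b n0 n1 n2 B s \<theta> *\<^sub>v xh \<theta>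
        = J_mat n0 n1 n2 s \<theta> *\<^sub>v xh \<theta> + G2 a b n0 n1 n2 B s \<theta> *\<^sub>v xh \<theta>"
      using add_mult_distrib_mat_vec[OF block_mat_carriers(5) G2c xhc[OF that]] by simp
    also have "J_mat n0 n1 n2 s \<theta> *\<^sub>v xh \<theta> = Jx \<theta>"
      unfolding xh[OF that] Jx_def using x0[OF that] x1c[OF that] x2c[OF that]
      by (rule J_mat_mult_vec)
    finally show ?thesis using G2x[OF that] by simp
  qed
  \<comment> \<open>Right-nested sums match the nesting of the appended blocks, which the append
    rules peel off one at a time.\<close>
  have N_eq: "?N = n1 + (n1 + (n2 + (n2 + (n2 + n2))))" by simp
  have n_eq: "?n = n0 + (n1 + n2)" by simp
  have Qx: "vec_integrable ?N {a..b} Qx"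
    unfolding N_eq Qx_def[abs_def]
    by (intro vec_integrable_append vec_integrable_zero x1 x2 vec_integrable_smult_continuous
        continuous_intros)
  have Qx_int: "vec_integral ?N {a..b} Qx = boundary_source x1 x2"
    unfolding N_eq Qx_def[abs_def] boundary_source_def
    by (simp only: vec_integral_append vec_integral_zero x1c x2c zero_carrier_vec
        append_carrier_vec smult_carrier_vec)
  have Jx: "vec_integrable ?n {a..s} Jx"
    unfolding n_eq Jx_def[abs_def] using s
    by (intro vec_integrable_append vec_integrable_zero vec_integrable_smult_continuous
        continuous_intros vec_integrable_subinterval[OF x1] vec_integrable_subinterval[OF x2]) auto
  have Jx_int: "vec_integral ?n {a..s} Jx = 0\<^sub>v n0 @\<^sub>v vec_integral n1 {a..s} x1
      @\<^sub>v vec_integral n2 {a..s} (\<lambda>\<theta>. (s - \<theta>) \<cdot>\<^sub>v x2 \<theta>)"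
  proof -
    have "x1 \<theta> \<in> carrier_vec n1" "x2 \<theta> \<in> carrier_vec n2" if "\<theta> \<in> {a..s}" for \<theta>
      using that s by (auto intro: x1c x2c)
    then show ?thesis
      unfolding n_eq Jx_def[abs_def]
      by (simp only: vec_integral_append vec_integral_zero zero_carrier_vec
          append_carrier_vec smult_carrier_vec)
  qed
  have Qs: "vec_integrable ?N {a..s} Qx" "vec_integrable ?N {s..b} Qx"
    using s by (auto intro: vec_integrable_subinterval[OF Qx])
  have "vec_integral ?n {a..s} (\<lambda>\<theta>. G1 a b n0 n1 n2 B s \<theta> *\<^sub>v xh \<theta>)
      = vec_integral ?n {a..s} (\<lambda>\<theta>. Jx \<theta> + M *\<^sub>v Qx \<theta>)"
    using s by (intro vec_integral_cong G1x) auto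
  also have "\<dots> = vec_integral ?n {a..s} Jx + M *\<^sub>v vec_integral ?N {a..s} Qx"
    by (simp only: vec_integral_add[OF Jx vec_integrable_mult_mat[OF M Qs(1)]]
        vec_integral_mult_mat[OF M Qs(1)])
  finally have I1: "vec_integral ?n {a..s} (\<lambda>\<theta>. G1 a b n0 n1 n2 B s \<theta> *\<^sub>v xh \<theta>)
      = vec_integral ?n {a..s} Jx + M *\<^sub>v vec_integral ?N {a..s} Qx" .
  have "vec_integral ?n {s..b} (\<lambda>\<theta>. G2 a b n0 n1 n2 B s \<theta> *\<^sub>v xh \<theta>)
      = vec_integral ?n {s..b} (\<lambda>\<theta>. M *\<^sub>v Qx \<theta>)"
    using s by (intro vec_integral_cong G2x) auto
  then have I2: "vec_integral ?n {s..b} (\<lambda>\<theta>. G2 a b n0 n1 n2 B s \<theta> *\<^sub>v xh \<theta>)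
      = M *\<^sub>v vec_integral ?N {s..b} Qx"
    by (simp only: vec_integral_mult_mat[OF M Qs(2)])
  \<comment> \<open>The two partial integrals share the integrand \<open>Qx\<close> and together
    cover [a,b]; this is the part of the operator that sees the whole interval.\<close>
  have "M *\<^sub>v vec_integral ?N {a..s} Qx + M *\<^sub>v vec_integral ?N {s..b} Qx
      = M *\<^sub>v (vec_integral ?N {a..s} Qx + vec_integral ?N {s..b} Qx)"
    by (rule mult_add_distrib_mat_vec[OF M vec_integral_carrier vec_integral_carrier, symmetric])
  also have "\<dots> = M *\<^sub>v boundary_source x1 x2"
    by (simp only: vec_integral_split[OF Qx s] Qx_int)
  also have "\<dots> = - ((?K * BT_inv * B) *\<^sub>v boundary_source x1 x2)"
    unfolding M_def using carrier_matD(2)[OF KB] carrier_vecD[OF boundary_source_carrier]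
    by (intro uminus_mult_mat_vec) (simp only:)
  also have "(?K * BT_inv * B) *\<^sub>v boundary_source x1 x2
      = ?K *\<^sub>v (BT_inv *\<^sub>v (B *\<^sub>v boundary_source x1 x2))"
    using assoc_mult_mat_vec[OF mult_carrier_mat[OF block_mat_carriers(2) BT_inv(1)] B boundary_source_carrier]
      assoc_mult_mat_vec[OF block_mat_carriers(2) BT_inv(1) mult_mat_vec_carrier[OF B boundary_source_carrier]]
    by simp
  also have "- \<dots> = ?K *\<^sub>v core_values x1 x2"
    unfolding core_values_def
    by (rule mult_uminus_mat_vec[OF block_mat_carriers(2)
        mult_mat_vec_carrier[OF BT_inv(1) mult_mat_vec_carrier[OF B boundary_source_carrier]], symmetric])
  also have "\<dots> = 0\<^sub>v n0 @\<^sub>v u @\<^sub>v (v + (s - a) \<cdot>\<^sub>v w)"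
    unfolding core using uvw by (rule K_mat_mult_vec)
  finally have M_sum: "M *\<^sub>v vec_integral ?N {a..s} Qx + M *\<^sub>v vec_integral ?N {s..b} Qx
      = 0\<^sub>v n0 @\<^sub>v u @\<^sub>v (v + (s - a) \<cdot>\<^sub>v w)" .
  have G0x: "G0 n0 n1 n2 s *\<^sub>v xh s = x0 s @\<^sub>v 0\<^sub>v n1 @\<^sub>v 0\<^sub>v n2"
    unfolding xh[OF s] using x0[OF s] x1c[OF s] x2c[OF s] by (rule G0_mult_vec)
  have Mc: "M *\<^sub>v vec_integral ?N S Qx \<in> carrier_vec ?n" for S
    using M vec_integral_carrier by (rule mult_mat_vec_carrier)
  have G0c: "G0 n0 n1 n2 s *\<^sub>v xh s \<in> carrier_vec ?n"
    using block_mat_carriers(4) xhc[OF s] by (rule mult_mat_vec_carrier)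
  have "T_op a b n0 n1 n2 B xh s
      = G0 n0 n1 n2 s *\<^sub>v xh s + (vec_integral ?n {a..s} Jx + M *\<^sub>v vec_integral ?N {a..s} Qx)
        + M *\<^sub>v vec_integral ?N {s..b} Qx"
    by (simp only: T_op_def PI_op_def I1 I2)
  also have "\<dots> = G0 n0 n1 n2 s *\<^sub>v xh s + vec_integral ?n {a..s} Jx
      + (M *\<^sub>v vec_integral ?N {a..s} Qx + M *\<^sub>v vec_integral ?N {s..b} Qx)"
    using Mc[of "{a..s}"] Mc[of "{s..b}"] G0c vec_integral_carrier[of ?n "{a..s}" Jx]
    by (intro eq_vecI) (simp_all add: carrier_vecD)
  also have "\<dots> = (x0 s @\<^sub>v 0\<^sub>v n1 @\<^sub>v 0\<^sub>v n2) + (0\<^sub>v n0 @\<^sub>v vec_integral n1 {a..s} x1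
      @\<^sub>v vec_integral n2 {a..s} (\<lambda>\<theta>. (s - \<theta>) \<cdot>\<^sub>v x2 \<theta>)) + (0\<^sub>v n0 @\<^sub>v u @\<^sub>v (v + (s - a) \<cdot>\<^sub>v w))"
    by (simp only: M_sum G0x Jx_int)
  also have "\<dots> = x0 s @\<^sub>v (u + vec_integral n1 {a..s} x1)
    @\<^sub>v (v + (s - a) \<cdot>\<^sub>v w + vec_integral n2 {a..s} (\<lambda>\<theta>. (s - \<theta>) \<cdot>\<^sub>v x2 \<theta>))"
    using carrier_vecD[OF x0[OF s]] carrier_vecD[OF uvw(1)] carrier_vecD[OF uvw(2)] carrier_vecD[OF uvw(3)]
    by (intro eq_vecI) auto
  finally show ?thesis .
qed

end

section \<open>Continuous representatives in Sobolev spaces\<close>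

lemma L2_cong:
  assumes "\<And>s. s \<in> {a..b} \<Longrightarrow> f s = g s"
  shows "f \<in> L2 a b m \<longleftrightarrow> g \<in> L2 a b m"
proof -
  have "(\<lambda>s. f s $ i) \<in> borel_measurable (lebesgue_on {a..b}) \<longleftrightarrow>
      (\<lambda>s. g s $ i) \<in> borel_measurable (lebesgue_on {a..b})"
    "integrable (lebesgue_on {a..b}) (\<lambda>s. (f s $ i)\<^sup>2) \<longleftrightarrow>
      integrable (lebesgue_on {a..b}) (\<lambda>s. (g s $ i)\<^sup>2)" for i
    using assms by (auto intro!: measurable_cong Bochner_Integration.integrable_cong)
  then show ?thesis using assms by (simp add: L2_def)
qed

lemma L2_continuousI:
  assumes "\<And>s. s \<in> {a..b} \<Longrightarrow> f s \<in> carrier_vec m"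
    and "\<And>i. i < m \<Longrightarrow> continuous_on {a..b} (\<lambda>s. f s $ i)"
  shows "f \<in> L2 a b m"
  using assms
  by (auto simp: L2_def intro!: continuous_imp_integrable_real continuous_on_power
      borel_measurable_integrable[OF continuous_imp_integrable_real])

text \<open>The interval has finite measure, so square integrable functions are integrable; the
  results on primitives ask for no more.\<close>

lemma L2_imp_vec_integrable:
  assumes "f \<in> L2 a b m"
  shows "vec_integrable m {a..b} f"
proof -
  have "finite_measure (lebesgue_on {a..b})"
    by (rule finite_measure_lebesgue_on) simp
  then show ?thesis
    using assms by (auto simp: L2_def vec_integrable_def intro: finite_measure.square_integrable_imp_integrable)
qed

lemma L2_component_integrable:
  "f \<in> L2 a b m \<Longrightarrow> i < m \<Longrightarrow> integrable (lebesgue_on {a..b}) (\<lambda>s. f s $ i)"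
  using L2_imp_vec_integrable by (simp add: vec_integrable_def)

lemma L2_mult_integrable:
  assumes "f \<in> L2 a b m" "g \<in> L2 a b m" "i < m"
  shows "integrable (lebesgue_on {a..b}) (\<lambda>s. f s $ i * g s $ i)"
proof (rule Bochner_Integration.integrable_bound)
  show "integrable (lebesgue_on {a..b}) (\<lambda>s. (f s $ i)\<^sup>2 + (g s $ i)\<^sup>2)"
    using assms by (auto simp: L2_def)
  show "AE s in lebesgue_on {a..b}. norm (f s $ i * g s $ i) \<le> norm ((f s $ i)\<^sup>2 + (g s $ i)\<^sup>2)"
  proof (rule AE_I2)
    fix s
    have "2 * \<bar>f s $ i * g s $ i\<bar> \<le> (f s $ i)\<^sup>2 + (g s $ i)\<^sup>2"
      using sum_squares_bound[of "\<bar>f s $ i\<bar>" "\<bar>g s $ i\<bar>"] by (simp add: abs_mult)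
    then show "norm (f s $ i * g s $ i) \<le> norm ((f s $ i)\<^sup>2 + (g s $ i)\<^sup>2)"
      by simp
  qed
qed (use assms in \<open>auto simp: L2_def intro!: borel_measurable_times\<close>)

lemma L2_scalar_prod:
  assumes "f \<in> L2 a b m" "g \<in> L2 a b m" "s \<in> {a..b}"
  shows "f s \<bullet> g s = (\<Sum>i<m. f s $ i * g s $ i)"
  using assms by (auto simp: L2_def scalar_prod_def atLeast0LessThan dest!: bspec[where x = s])

lemma L2_scalar_prod_integrable:
  assumes "f \<in> L2 a b m" "g \<in> L2 a b m"
  shows "integrable (lebesgue_on {a..b}) (\<lambda>s. f s \<bullet> g s)"
proof -
  have "integrable (lebesgue_on {a..b}) (\<lambda>s. \<Sum>i<m. f s $ i * g s $ i)"
    using assms by (intro Bochner_Integration.integrable_sum L2_mult_integrable) auto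
  then show ?thesis
    by (rule Bochner_Integration.integrable_cong[THEN iffD1, rotated -1])
      (use L2_scalar_prod[OF assms] in auto)
qed

text \<open>Makes \<open>X_inner\<close> independent of the representatives that
  \<open>wderiv\<close> happens to choose.\<close>

lemma L2_inner_AE_cong:
  assumes "f \<in> L2 a b m" "f' \<in> L2 a b m" "g \<in> L2 a b m" "g' \<in> L2 a b m"
    and "AE s in lebesgue_on {a..b}. f s = f' s" "AE s in lebesgue_on {a..b}. g s = g' s"
  shows "L2_inner a b f g = L2_inner a b f' g'"
  unfolding L2_inner_def
proof (rule integral_cong_AE)
  show "AE s in lebesgue_on {a..b}. f s \<bullet> g s = f' s \<bullet> g' s"
    using assms(5,6) by eventually_elim simp
qed (use L2_scalar_prod_integrable assms in \<open>blast intro: borel_measurable_integrable\<close>)+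

section \<open>Splitting a stacked function into its blocks\<close>

lemma block_carrier [simp]: "block k m x s \<in> carrier_vec m"
  by (simp add: block_def)

lemma block_dim [simp]: "dim_vec (block k m x s) = m"
  by (simp add: block_def)

lemma append_blocks:
  assumes "x s \<in> carrier_vec (n0 + n1 + n2)"
  shows "x s = block 0 n0 x s @\<^sub>v block n0 n1 x s @\<^sub>v block (n0 + n1) n2 x s"
  using carrier_vecD[OF assms] by (intro eq_vecI) (auto simp: block_def)

lemma block_append:
  assumes "x s = u @\<^sub>v v @\<^sub>v w" "u \<in> carrier_vec n0" "v \<in> carrier_vec n1" "w \<in> carrier_vec n2"
  shows "block 0 n0 x s = u" "block n0 n1 x s = v" "block (n0 + n1) n2 x s = w"
  using assms by (auto intro!: eq_vecI simp: block_def carrier_vecD)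

lemma block_L2: "x \<in> L2 a b n \<Longrightarrow> k + m \<le> n \<Longrightarrow> block k m x \<in> L2 a b m"
  by (auto simp: L2_def block_def)

lemma L2_inner_blocks:
  assumes x: "x \<in> L2 a b (n0 + n1 + n2)" and y: "y \<in> L2 a b (n0 + n1 + n2)"
  shows "L2_inner a b x y = L2_inner a b (block 0 n0 x) (block 0 n0 y)
    + L2_inner a b (block n0 n1 x) (block n0 n1 y)
    + L2_inner a b (block (n0 + n1) n2 x) (block (n0 + n1) n2 y)"
proof -
  have "L2_inner a b x y = (\<integral>s. block 0 n0 x s \<bullet> block 0 n0 y s + block n0 n1 x s \<bullet> block n0 n1 y s
      + block (n0 + n1) n2 x s \<bullet> block (n0 + n1) n2 y s \<partial>lebesgue_on {a..b})"
    unfolding L2_inner_def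
  proof (rule Bochner_Integration.integral_cong)
    fix s assume "s \<in> space (lebesgue_on {a..b})"
    then have c: "x s \<in> carrier_vec (n0 + n1 + n2)" "y s \<in> carrier_vec (n0 + n1 + n2)"
      using x y by (auto simp: L2_def)
    show "x s \<bullet> y s = block 0 n0 x s \<bullet> block 0 n0 y s + block n0 n1 x s \<bullet> block n0 n1 y s
      + block (n0 + n1) n2 x s \<bullet> block (n0 + n1) n2 y s"
      unfolding append_blocks[of x s, OF c(1)] append_blocks[of y s, OF c(2)]
        scalar_prod_append[OF block_carrier append_carrier_vec[OF block_carrier block_carrier]
          block_carrier append_carrier_vec[OF block_carrier block_carrier]]
        scalar_prod_append[OF block_carrier block_carrier block_carrier block_carrier]
      by simp
  qed simp
  also have "\<dots> = L2_inner a b (block 0 n0 x) (block 0 n0 y)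
    + L2_inner a b (block n0 n1 x) (block n0 n1 y)
    + L2_inner a b (block (n0 + n1) n2 x) (block (n0 + n1) n2 y)"
  proof -
    have "integrable (lebesgue_on {a..b}) (\<lambda>s. block k m x s \<bullet> block k m y s)" if "k + m \<le> n0 + n1 + n2" for k m
      by (rule L2_scalar_prod_integrable[OF block_L2[OF x that] block_L2[OF y that]])
    from this[of 0 n0] this[of n0 n1] this[of "n0 + n1" n2] show ?thesis
      unfolding L2_inner_def by simp
  qed
  finally show ?thesis .
qed

section \<open>Weak derivatives of vector-valued functions\<close>

lemma weak_deriv_cong:
  assumes "\<And>s. s \<in> {a..b} \<Longrightarrow> f s = f' s" "\<And>s. s \<in> {a..b} \<Longrightarrow> g s = g' s"
  shows "weak_deriv a b m k f g \<longleftrightarrow> weak_deriv a b m k f' g'"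
proof -
  have "(\<integral>s. f s $ i * \<psi> s \<partial>lebesgue_on {a..b}) = (\<integral>s. f' s $ i * \<psi> s \<partial>lebesgue_on {a..b})"
    "(\<integral>s. g s $ i * \<psi> s \<partial>lebesgue_on {a..b}) = (\<integral>s. g' s $ i * \<psi> s \<partial>lebesgue_on {a..b})" for i \<psi>
    using assms by (auto intro!: Bochner_Integration.integral_cong)
  then show ?thesis by (simp add: weak_deriv_def)
qed

lemma weak_deriv_comp:
  assumes "weak_deriv a b m j f g"
  shows "weak_deriv a b m k g h \<longleftrightarrow> weak_deriv a b m (j + k) f h"
proof -
  have "scalar_weak_deriv a b j (\<lambda>s. f s $ i) (\<lambda>s. g s $ i)" if "i < m" for i
    using assms that by (simp add: weak_deriv_iff_scalar)
  then show ?thesis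
    unfolding weak_deriv_iff_scalar using scalar_weak_deriv_comp by blast
qed

lemma weak_deriv_0_refl: "weak_deriv a b m 0 f f"
  by (simp add: weak_deriv_def)

lemma weak_deriv_primitive:
  assumes "a < b" and c: "c \<in> carrier_vec m" and g: "vec_integrable m {a..b} g"
  shows "weak_deriv a b m 1 (\<lambda>s. c + vec_integral m {a..s} g) g"
proof -
  have "(c + vec_integral m {a..s} g) $ i = c $ i + (\<integral>t. g t $ i \<partial>lebesgue_on {a..s})" if "i < m" for s i
    using that by (simp add: vec_integral_def)
  then show ?thesis
    using g scalar_weak_deriv_primitive[OF assms(1)]
    by (simp add: weak_deriv_iff_scalar vec_integrable_def)
qed

lemma wderiv_spec:
  assumes "g \<in> L2 a b m" "weak_deriv a b m k f g"
  shows "wderiv a b m k f \<in> L2 a b m" "weak_deriv a b m k f (wderiv a b m k f)"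
  using someI[of "\<lambda>g. g \<in> L2 a b m \<and> weak_deriv a b m k f g" g] assms
  by (auto simp: wderiv_def)

lemma Sobolev_wderiv:
  assumes "f \<in> Sobolev a b k m" "j \<le> k"
  shows "wderiv a b m j f \<in> L2 a b m" "weak_deriv a b m j f (wderiv a b m j f)"
  using assms wderiv_spec unfolding Sobolev_def by blast+

lemma L2_AE_eqI:
  assumes "f \<in> L2 a b m" "g \<in> L2 a b m"
    and "\<And>i. i < m \<Longrightarrow> AE s in lebesgue_on {a..b}. f s $ i = g s $ i"
  shows "AE s in lebesgue_on {a..b}. f s = g s"
proof -
  have "AE s in lebesgue_on {a..b}. \<forall>i\<in>{..<m}. f s $ i = g s $ i"
    using assms(3) by (intro AE_finite_allI) auto
  then show ?thesis
    using AE_space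
  proof eventually_elim
    case (elim s)
    then have "f s \<in> carrier_vec m" "g s \<in> carrier_vec m"
      using assms(1,2) by (auto simp: L2_def)
    with elim show ?case by (intro eq_vecI) (auto simp: carrier_vecD)
  qed
qed

text \<open>The choice made by \<open>wderiv\<close> is controlled only through uniqueness: once
  some weak derivative g is exhibited, the chosen one can differ from it only on a null set.\<close>

lemma wderiv_AE_eq:
  assumes "g \<in> L2 a b m" "weak_deriv a b m k f g"
  shows "AE s in lebesgue_on {a..b}. wderiv a b m k f s = g s"
proof (rule L2_AE_eqI[OF wderiv_spec(1)[OF assms] assms(1)])
  fix i assume "i < m"
  then show "AE s in lebesgue_on {a..b}. wderiv a b m k f s $ i = g s $ i"
    using assms wderiv_spec[OF assms]
    by (intro scalar_weak_deriv_unique[where k = k and f = "\<lambda>s. f s $ i"] L2_component_integrable)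
      (auto simp: weak_deriv_iff_scalar)
qed

section \<open>Point values through continuous representatives\<close>

lemma point_value_carrier [simp]: "point_value a b m f t \<in> carrier_vec m"
  by (simp add: point_value_def)

lemma point_value_dim [simp]: "dim_vec (point_value a b m f t) = m"
  by (simp add: point_value_def)

text \<open>The chosen continuous representative and h agree almost everywhere, hence everywhere on
  [a,b], so the choice is immaterial there.\<close>

lemma point_value_component_eq:
  assumes "a < b" "t \<in> {a..b}" "i < m" and h: "continuous_on {a..b} h"
    and ae: "AE s in lebesgue_on {a..b}. f s $ i = h s"
  shows "point_value a b m f t $ i = h t"
proof -
  let ?P = "\<lambda>g. continuous_on {a..b} g \<and> (AE s in lebesgue_on {a..b}. g s = f s $ i)"
  have "?P h" using h ae by (auto elim: eventually_mono)
  then have P: "?P (Eps ?P)" by (rule someI[of ?P])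
  have "AE s in lebesgue_on {a..b}. Eps ?P s = h s"
    using ae P[THEN conjunct2] by eventually_elim simp
  then have "Eps ?P t = h t"
    by (rule continuous_AE_eq_imp_eq[OF assms(1) P[THEN conjunct1] h _ assms(2)])
  then show ?thesis using assms(3) by (simp add: point_value_def)
qed

lemma point_value_eq:
  assumes "a < b" "t \<in> {a..b}" "h t \<in> carrier_vec m"
    and "\<And>i. i < m \<Longrightarrow> continuous_on {a..b} (\<lambda>s. h s $ i)"
    and ae: "AE s in lebesgue_on {a..b}. f s = h s"
  shows "point_value a b m f t = h t"
proof (rule eq_vecI)
  fix i assume "i < dim_vec (h t)"
  then have "i < m" using assms(3) by (simp add: carrier_vecD)
  moreover have "AE s in lebesgue_on {a..b}. f s $ i = h s $ i"
    using ae by eventually_elim simp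
  ultimately show "point_value a b m f t $ i = h t $ i"
    using assms by (intro point_value_component_eq) auto
qed (use assms in auto)

lemma vec_integral_singleton: "vec_integral m {a..a} f = 0\<^sub>v m"
proof -
  have "(\<integral>t. f t $ i \<partial>lebesgue_on {a..a}) = 0" for i
    by (intro integral_eq_zero_AE AE_lebesgue_onI_negligible[of "{a}"]) auto
  then show ?thesis by (auto intro!: eq_vecI simp: vec_integral_def)
qed

lemma continuous_on_vec_primitive:
  assumes "vec_integrable m {a..b} g" "i < m"
  shows "continuous_on {a..b} (\<lambda>s. vec_integral m {a..s} g $ i)"
  using assms continuous_on_primitive[of a b "\<lambda>t. g t $ i"]
  by (simp add: vec_integral_def vec_integrable_def)

text \<open>The derivative g is a parameter instead of \<open>wderiv\<close> of f, because later the
  chosen second derivative of a function plays the derivative of its chosen first one.\<close>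

lemma H1_representative:
  assumes "a < b" and f: "f \<in> L2 a b m" and g: "g \<in> L2 a b m" and w: "weak_deriv a b m 1 f g"
  shows "t \<in> {a..b} \<Longrightarrow> point_value a b m f t = point_value a b m f a + vec_integral m {a..t} g"
    and "AE s in lebesgue_on {a..b}. f s = point_value a b m f s"
proof -
  have *: "\<exists>c. (AE s in lebesgue_on {a..b}. f s $ i = c + vec_integral m {a..s} g $ i) \<and>
      (\<forall>t\<in>{a..b}. point_value a b m f t $ i = c + vec_integral m {a..t} g $ i)" if i: "i < m" for i
  proof -
    have "scalar_weak_deriv a b 1 (\<lambda>s. f s $ i) (\<lambda>s. g s $ i)"
      using w i by (simp add: weak_deriv_iff_scalar)
    then obtain c where "AE s in lebesgue_on {a..b}. f s $ i = c + (\<integral>t. g t $ i \<partial>lebesgue_on {a..s})"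
      using scalar_weak_deriv_1_imp_primitive[OF assms(1) L2_component_integrable[OF f i]
          L2_component_integrable[OF g i]] by blast
    then have c: "AE s in lebesgue_on {a..b}. f s $ i = c + vec_integral m {a..s} g $ i"
      using i by (simp add: vec_integral_def)
    have "continuous_on {a..b} (\<lambda>s. c + vec_integral m {a..s} g $ i)"
      by (intro continuous_intros continuous_on_vec_primitive L2_imp_vec_integrable g i)
    from point_value_component_eq[OF assms(1) _ i this c] show ?thesis
      using c by (intro exI[of _ c]) auto
  qed
  \<comment> \<open>The primitive starts at 0, so the constant c of each component is the value at
    a.\<close>
  have a: "vec_integral m {a..a} g = 0\<^sub>v m" by (rule vec_integral_singleton)
  show eq: "point_value a b m f t = point_value a b m f a + vec_integral m {a..t} g" if "t \<in> {a..b}" for t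
  proof (rule eq_vecI)
    fix i assume "i < dim_vec (point_value a b m f a + vec_integral m {a..t} g)"
    then have i: "i < m" by simp
    with *[OF i] obtain c where
      "\<forall>t\<in>{a..b}. point_value a b m f t $ i = c + vec_integral m {a..t} g $ i" by blast
    from bspec[OF this that] bspec[OF this, of a] assms(1) a i
    show "point_value a b m f t $ i = (point_value a b m f a + vec_integral m {a..t} g) $ i"
      by simp
  qed simp
  have "AE s in lebesgue_on {a..b}. \<forall>i\<in>{..<m}. f s $ i = point_value a b m f s $ i"
  proof (rule AE_finite_allI)
    fix i assume "i \<in> {..<m}"
    then have "i < m" by simp
    with * obtain c where c: "AE s in lebesgue_on {a..b}. f s $ i = c + vec_integral m {a..s} g $ i"
      "\<forall>t\<in>{a..b}. point_value a b m f t $ i = c + vec_integral m {a..t} g $ i" by blast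
    show "AE s in lebesgue_on {a..b}. f s $ i = point_value a b m f s $ i"
      using c(1) AE_space by eventually_elim (use c(2) in auto)
  qed simp
  then show "AE s in lebesgue_on {a..b}. f s = point_value a b m f s"
    using AE_space
  proof eventually_elim
    case (elim s)
    then have "f s \<in> carrier_vec m" using f by (auto simp: L2_def)
    with elim show ?case by (intro eq_vecI) (auto simp: carrier_vecD)
  qed
qed

text \<open>The constant w integrates to (s - a) w and the iterated integral of g collapses to the
  kernel s - t. These are the origins of the entry s - a in K and of the entry s - \<theta> in
  G1.\<close>

lemma vec_integral_affine_primitive:
  assumes g: "vec_integrable m {a..b} g" and s: "s \<in> {a..b}" and w: "w \<in> carrier_vec m"
  shows "vec_integral m {a..s} (\<lambda>u. w + vec_integral m {a..u} g)
    = (s - a) \<cdot>\<^sub>v w + vec_integral m {a..s} (\<lambda>t. (s - t) \<cdot>\<^sub>v g t)"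
proof (rule eq_vecI)
  fix i assume "i < dim_vec ((s - a) \<cdot>\<^sub>v w + vec_integral m {a..s} (\<lambda>t. (s - t) \<cdot>\<^sub>v g t))"
  then have i: "i < m" by simp
  have gi: "integrable (lebesgue_on {a..b}) (\<lambda>t. g t $ i)"
    using g i by (simp add: vec_integrable_def)
  have gs: "integrable (lebesgue_on {a..s}) (\<lambda>t. g t $ i)"
    using gi by (rule integrable_lebesgue_on_subinterval) (use s in auto)
  have const: "(\<integral>u. w $ i \<partial>lebesgue_on {a..s}) = (s - a) * w $ i"
    using s LINT_lebesgue_on_eq_integral[of a s "\<lambda>_. w $ i" a s]
    by (simp add: continuous_imp_integrable_real)
  have "vec_integral m {a..s} (\<lambda>u. w + vec_integral m {a..u} g) $ i
      = (\<integral>u. w $ i + (\<integral>t. g t $ i \<partial>lebesgue_on {a..u}) \<partial>lebesgue_on {a..s})"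
    using i w by (simp add: vec_integral_def carrier_vecD)
  also have "\<dots> = (s - a) * w $ i + (\<integral>u. (\<integral>t. g t $ i \<partial>lebesgue_on {a..u}) \<partial>lebesgue_on {a..s})"
    by (subst Bochner_Integration.integral_add)
      (simp_all only: const, auto intro!: continuous_imp_integrable_real continuous_on_primitive gs)
  also have "\<dots> = (s - a) * w $ i + (\<integral>t. (s - t) * g t $ i \<partial>lebesgue_on {a..s})"
    by (simp only: double_primitive[OF gi s])
  also have "(\<integral>t. (s - t) * g t $ i \<partial>lebesgue_on {a..s}) = vec_integral m {a..s} (\<lambda>t. (s - t) \<cdot>\<^sub>v g t) $ i"
    unfolding vec_integral_def index_vec[OF i]
  proof (rule Bochner_Integration.integral_cong)
    fix t assume "t \<in> space (lebesgue_on {a..s})"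
    then have "g t \<in> carrier_vec m" using g s by (auto simp: vec_integrable_def)
    then show "(s - t) * g t $ i = ((s - t) \<cdot>\<^sub>v g t) $ i" using i by (simp add: carrier_vecD)
  qed simp
  finally show "vec_integral m {a..s} (\<lambda>u. w + vec_integral m {a..u} g) $ i
    = ((s - a) \<cdot>\<^sub>v w + vec_integral m {a..s} (\<lambda>t. (s - t) \<cdot>\<^sub>v g t)) $ i"
    using i w by (simp add: carrier_vecD)
qed (use w in simp)

lemma vec_integral_AE_cong:
  assumes "vec_integrable m {a..b} f" "vec_integrable m {a..b} g" "s \<in> {a..b}"
    and ae: "AE t in lebesgue_on {a..b}. f t = g t"
  shows "vec_integral m {a..s} f = vec_integral m {a..s} g"
proof (rule eq_vecI)
  fix i assume "i < dim_vec (vec_integral m {a..s} g)"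
  then have i: "i < m" by simp
  have fg: "vec_integrable m {a..s} f" "vec_integrable m {a..s} g"
    using assms(1-3) by (auto intro: vec_integrable_subinterval)
  have "AE t in lebesgue_on {a..s}. f t $ i = g t $ i"
    using ae assms(3) by (auto simp: AE_restrict_space_iff elim!: eventually_mono)
  then have "(\<integral>t. f t $ i \<partial>lebesgue_on {a..s}) = (\<integral>t. g t $ i \<partial>lebesgue_on {a..s})"
    using fg i by (intro integral_cong_AE) (auto simp: vec_integrable_def)
  then show "vec_integral m {a..s} f $ i = vec_integral m {a..s} g $ i"
    using i by (simp add: vec_integral_def)
qed simp

text \<open>Taylor's formula at a with integral remainder, obtained by using the H1 representation
  for f1 and then for f.\<close>

lemma H2_representative:
  assumes "a < b" and f: "f \<in> Sobolev a b 2 m"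
  defines "f1 \<equiv> wderiv a b m 1 f" and "f2 \<equiv> wderiv a b m 2 f"
  shows "t \<in> {a..b} \<Longrightarrow> point_value a b m f1 t = point_value a b m f1 a + vec_integral m {a..t} f2"
    and "t \<in> {a..b} \<Longrightarrow> point_value a b m f t = point_value a b m f a
      + (t - a) \<cdot>\<^sub>v point_value a b m f1 a + vec_integral m {a..t} (\<lambda>\<theta>. (t - \<theta>) \<cdot>\<^sub>v f2 \<theta>)"
    and "AE s in lebesgue_on {a..b}. f s = point_value a b m f s"
proof -
  have L2: "f \<in> L2 a b m" "f1 \<in> L2 a b m" "f2 \<in> L2 a b m"
    using f Sobolev_wderiv[OF f] by (auto simp: f1_def f2_def Sobolev_def)
  have w1: "weak_deriv a b m 1 f f1" and w2: "weak_deriv a b m 2 f f2"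
    using Sobolev_wderiv[OF f] by (auto simp: f1_def f2_def)
  \<comment> \<open>\<open>f1\<close> and \<open>f2\<close> are separate choices, both made from f;
    the composition rule links them.\<close>
  have w12: "weak_deriv a b m 1 f1 f2"
    using weak_deriv_comp[OF w1, of 1 f2] w2 by (simp add: numeral_2_eq_2)
  note r1 = H1_representative[OF assms(1) L2(2,3) w12]
  note r = H1_representative[OF assms(1) L2(1,2) w1]
  show "AE s in lebesgue_on {a..b}. f s = point_value a b m f s" by (rule r(2))
  show "point_value a b m f1 t = point_value a b m f1 a + vec_integral m {a..t} f2" if "t \<in> {a..b}" for t
    using that by (rule r1(1))
  assume t: "t \<in> {a..b}"
  let ?p = "point_value a b m f1 a" and ?G = "\<lambda>u. point_value a b m f1 a + vec_integral m {a..u} f2"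
  have f2i: "vec_integrable m {a..b} f2" by (rule L2_imp_vec_integrable[OF L2(3)])
  have "?G \<in> L2 a b m"
    using continuous_on_vec_primitive[OF f2i]
    by (intro L2_continuousI) (auto intro!: continuous_intros)
  \<comment> \<open>\<open>f1\<close> equals its continuous representative only almost everywhere,
    which is enough under the integral.\<close>
  moreover have "AE s in lebesgue_on {a..b}. f1 s = ?G s"
    using r1(2) AE_space
  proof eventually_elim
    case (elim s)
    have "point_value a b m f1 s = ?G s" using elim(2) by (intro r1(1)) simp
    with elim(1) show ?case by (rule trans)
  qed
  ultimately have "vec_integral m {a..t} f1 = vec_integral m {a..t} ?G"
    using t L2 by (intro vec_integral_AE_cong[where b = b] L2_imp_vec_integrable)
  also have "\<dots> = (t - a) \<cdot>\<^sub>v ?p + vec_integral m {a..t} (\<lambda>\<theta>. (t - \<theta>) \<cdot>\<^sub>v f2 \<theta>)"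
    using f2i t point_value_carrier by (rule vec_integral_affine_primitive)
  finally show "point_value a b m f t = point_value a b m f a + (t - a) \<cdot>\<^sub>v ?p
      + vec_integral m {a..t} (\<lambda>\<theta>. (t - \<theta>) \<cdot>\<^sub>v f2 \<theta>)"
    using r(1)[OF t] by (simp add: assoc_add_vec[of _ m])
qed

section \<open>Reconstruction, membership in X and isometry\<close>

context boundary_system
begin

text \<open>T c holds what the constant and affine parts contribute to the six boundary values, and
  the source holds what the primitives contribute.\<close>

lemma boundary_values_eq:
  assumes uvw: "u \<in> carrier_vec n1" "v \<in> carrier_vec n2" "w \<in> carrier_vec n2"
  shows "T_mat a b n1 n2 *\<^sub>v (u @\<^sub>v v @\<^sub>v w) + boundary_source x1 x2
    = u @\<^sub>v (u + vec_integral n1 {a..b} x1) @\<^sub>v v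
      @\<^sub>v (v + (b - a) \<cdot>\<^sub>v w + vec_integral n2 {a..b} (\<lambda>\<theta>. (b - \<theta>) \<cdot>\<^sub>v x2 \<theta>))
      @\<^sub>v w @\<^sub>v (w + vec_integral n2 {a..b} x2)"
  unfolding T_mat_mult_vec[OF uvw] boundary_source_def
  using carrier_vecD[OF uvw(1)] carrier_vecD[OF uvw(2)] carrier_vecD[OF uvw(3)]
  by (intro eq_vecI) auto

lemma T_op_diag_deriv:
  assumes x: "x \<in> X_space a b n0 n1 n2 B"
  shows "L2_eq a b x (T_op a b n0 n1 n2 B (diag_deriv a b n0 n1 n2 x))"
proof -
  define x0 where "x0 = block 0 n0 x"
  define x1 where "x1 = block n0 n1 x"
  define x2 where "x2 = block (n0 + n1) n2 x"
  define y1 where "y1 = wderiv a b n1 1 x1"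
  define x2s where "x2s = wderiv a b n2 1 x2"
  define y2 where "y2 = wderiv a b n2 2 x2"
  let ?u = "point_value a b n1 x1 a" and ?v = "point_value a b n2 x2 a"
    and ?w = "point_value a b n2 x2s a"
  have xc: "x s \<in> carrier_vec (n0 + n1 + n2)" if "s \<in> {a..b}" for s
    using x that by (simp add: X_space_def)
  have S1: "x1 \<in> Sobolev a b 1 n1" and S2: "x2 \<in> Sobolev a b 2 n2"
    and bc: "B *\<^sub>v (?u @\<^sub>v point_value a b n1 x1 b @\<^sub>v ?v @\<^sub>v point_value a b n2 x2 b
        @\<^sub>v ?w @\<^sub>v point_value a b n2 x2s b) = 0\<^sub>v (n1 + 2 * n2)"
    using x by (simp_all add: X_space_def Let_def x1_def x2_def x2s_def)
  have L2_x1: "x1 \<in> L2 a b n1" using S1 by (simp add: Sobolev_def)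
  have L2_y1: "y1 \<in> L2 a b n1" and w_y1: "weak_deriv a b n1 1 x1 y1"
    unfolding y1_def using Sobolev_wderiv[OF S1] by auto
  have L2_y2: "y2 \<in> L2 a b n2"
    unfolding y2_def using Sobolev_wderiv[OF S2] by auto
  note r1 = H1_representative[OF ab L2_x1 L2_y1 w_y1]
  note r2 = H2_representative[OF ab S2, folded x2s_def y2_def]
  have "b \<in> {a..b}" using ab by simp
  \<comment> \<open>The representations at b turn the boundary condition of x into the linear
    equation for its own values at a, whose only solution is \<open>core_values\<close>.\<close>
  then have "B *\<^sub>v (T_mat a b n1 n2 *\<^sub>v (?u @\<^sub>v ?v @\<^sub>v ?w) + boundary_source y1 y2) = 0\<^sub>v (n1 + 2 * n2)"
    unfolding boundary_values_eq[OF point_value_carrier point_value_carrier point_value_carrier]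
    using bc r1(1)[of b] r2(1)[of b] r2(2)[of b] by simp
  then have core: "core_values y1 y2 = ?u @\<^sub>v ?v @\<^sub>v ?w"
    by (simp add: boundary_condition_iff append_carrier_vec_triple)
  \<comment> \<open>The operator reproduces the continuous representatives at every point of [a,b];
    only the comparison with x itself is almost everywhere.\<close>
  have T: "T_op a b n0 n1 n2 B (diag_deriv a b n0 n1 n2 x) s
      = x0 s @\<^sub>v point_value a b n1 x1 s @\<^sub>v point_value a b n2 x2 s" if s: "s \<in> {a..b}" for s
  proof -
    have "T_op a b n0 n1 n2 B (diag_deriv a b n0 n1 n2 x) s
        = x0 s @\<^sub>v (?u + vec_integral n1 {a..s} y1)
          @\<^sub>v (?v + (s - a) \<cdot>\<^sub>v ?w + vec_integral n2 {a..s} (\<lambda>\<theta>. (s - \<theta>) \<cdot>\<^sub>v y2 \<theta>))"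
      using _ _ L2_imp_vec_integrable[OF L2_y1] L2_imp_vec_integrable[OF L2_y2]
        point_value_carrier point_value_carrier point_value_carrier core s
      by (rule T_op_eq) (simp_all add: diag_deriv_def x0_def y1_def y2_def x1_def x2_def)
    then show ?thesis
      by (simp only: r1(1)[OF s] r2(2)[OF s])
  qed
  have "AE s in lebesgue_on {a..b}. x s = T_op a b n0 n1 n2 B (diag_deriv a b n0 n1 n2 x) s"
    using r1(2) r2(3) AE_space
  proof eventually_elim
    case (elim s)
    then have s: "s \<in> {a..b}" by simp
    have "x s = x0 s @\<^sub>v x1 s @\<^sub>v x2 s"
      unfolding x0_def x1_def x2_def by (rule append_blocks[of x s, OF xc[OF s]])
    with elim(1,2) show ?case by (simp only: T[OF s])
  qed
  then show ?thesis by (simp add: L2_eq_def)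
qed

text \<open>The claims are proved together because they rest on the same functions:
  \<open>F1\<close>, and \<open>F2\<close> with derivative \<open>G\<close>, built with the
  constants in \<open>core_values\<close>.\<close>

lemma
  assumes xh: "xh \<in> L2 a b (n0 + n1 + n2)"
  defines "y \<equiv> T_op a b n0 n1 n2 B xh"
  shows T_op_in_X_space: "y \<in> X_space a b n0 n1 n2 B"
    and T_op_block_0: "s \<in> {a..b} \<Longrightarrow> block 0 n0 y s = block 0 n0 xh s"
    and T_op_wderiv_1: "wderiv a b n1 1 (block n0 n1 y) \<in> L2 a b n1"
      "AE s in lebesgue_on {a..b}. wderiv a b n1 1 (block n0 n1 y) s = block n0 n1 xh s"
    and T_op_wderiv_2: "wderiv a b n2 2 (block (n0 + n1) n2 y) \<in> L2 a b n2"
      "AE s in lebesgue_on {a..b}. wderiv a b n2 2 (block (n0 + n1) n2 y) s = block (n0 + n1) n2 xh s"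
proof -
  define x0 where "x0 = block 0 n0 xh"
  define x1 where "x1 = block n0 n1 xh"
  define x2 where "x2 = block (n0 + n1) n2 xh"
  have L2x: "x0 \<in> L2 a b n0" "x1 \<in> L2 a b n1" "x2 \<in> L2 a b n2"
    unfolding x0_def x1_def x2_def by (auto intro!: block_L2[OF xh])
  note x1i = L2_imp_vec_integrable[OF L2x(2)] and x2i = L2_imp_vec_integrable[OF L2x(3)]
  \<comment> \<open>Its three blocks are the values at a prescribed for the n1 block, the n2 block
    and the derivative of the n2 block.\<close>
  have "core_values x1 x2 \<in> carrier_vec (n1 + (n2 + n2))"
    using core_values_carrier[of x1 x2] by (simp add: mult_2)
  then obtain u vw where u: "u \<in> carrier_vec n1" and vw: "vw \<in> carrier_vec (n2 + n2)"
    and core1: "core_values x1 x2 = u @\<^sub>v vw"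
    by (rule carrier_vec_appendE)
  from vw obtain v w where vw: "v \<in> carrier_vec n2" "w \<in> carrier_vec n2" "vw = v @\<^sub>v w"
    by (rule carrier_vec_appendE)
  note uvw = u vw(1,2)
  have core: "core_values x1 x2 = u @\<^sub>v v @\<^sub>v w" using core1 vw(3) by simp
  define F1 where "F1 s = u + vec_integral n1 {a..s} x1" for s
  \<comment> \<open>\<open>F2\<close> is built by integrating \<open>G\<close>, so that both of its
    weak derivatives come from the rule for primitives; \<open>F2_eq\<close> recovers the kernel s -
    \<theta> of the operator.\<close>
  define G where "G s = w + vec_integral n2 {a..s} x2" for s
  define F2 where "F2 s = v + vec_integral n2 {a..s} G" for s
  have F1c: "F1 s \<in> carrier_vec n1" and F2c: "F2 s \<in> carrier_vec n2" and Gc: "G s \<in> carrier_vec n2" for s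
    using uvw by (simp_all add: F1_def F2_def G_def)
  have cont: "continuous_on {a..b} (\<lambda>s. (c + vec_integral m {a..s} g) $ i)"
    if "vec_integrable m {a..b} g" "i < m" for c g m i
    using that by (auto intro!: continuous_intros continuous_on_vec_primitive)
  have F1cont: "continuous_on {a..b} (\<lambda>s. F1 s $ i)" if "i < n1" for i
    unfolding F1_def using x1i that by (rule cont)
  have Gcont: "continuous_on {a..b} (\<lambda>s. G s $ i)" if "i < n2" for i
    unfolding G_def using x2i that by (rule cont)
  have G_L2: "G \<in> L2 a b n2" using Gc Gcont by (rule L2_continuousI)
  note Gi = L2_imp_vec_integrable[OF G_L2]
  have F2cont: "continuous_on {a..b} (\<lambda>s. F2 s $ i)" if "i < n2" for i
    unfolding F2_def using Gi that by (rule cont)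
  have F1_L2: "F1 \<in> L2 a b n1" using F1c F1cont by (rule L2_continuousI)
  have F2_L2: "F2 \<in> L2 a b n2" using F2c F2cont by (rule L2_continuousI)
  have F2_eq: "F2 s = v + (s - a) \<cdot>\<^sub>v w + vec_integral n2 {a..s} (\<lambda>\<theta>. (s - \<theta>) \<cdot>\<^sub>v x2 \<theta>)"
    if s: "s \<in> {a..b}" for s
    unfolding F2_def G_def[abs_def] vec_integral_affine_primitive[OF x2i s uvw(3)]
    using uvw by (simp add: assoc_add_vec[of _ n2])
  have y: "y s = x0 s @\<^sub>v F1 s @\<^sub>v F2 s" if s: "s \<in> {a..b}" for s
    unfolding y_def F2_eq[OF s] unfolding F1_def
  proof (rule T_op_eq[OF _ _ x1i x2i uvw core s])
    show "xh t = x0 t @\<^sub>v x1 t @\<^sub>v x2 t" if "t \<in> {a..b}" for t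
      unfolding x0_def x1_def x2_def using that xh
      by (intro append_blocks) (auto simp: L2_def)
    show "x0 t \<in> carrier_vec n0" for t by (simp add: x0_def)
  qed
  have x0c: "x0 s \<in> carrier_vec n0" for s by (simp add: x0_def)
  note y_blocks = block_append[of y s "x0 s" "F1 s" "F2 s" n0 n1 n2 for s, OF y x0c F1c F2c]
  define y1 where "y1 = block n0 n1 y"
  define y2 where "y2 = block (n0 + n1) n2 y"
  have y1: "y1 s = F1 s" and y2: "y2 s = F2 s" if "s \<in> {a..b}" for s
    using y_blocks[OF that] by (simp_all add: y1_def y2_def)
  have y1_L2: "y1 \<in> L2 a b n1" using F1_L2 L2_cong[of a b y1 F1] y1 by blast
  have y2_L2: "y2 \<in> L2 a b n2" using F2_L2 L2_cong[of a b y2 F2] y2 by blast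
  have d1: "weak_deriv a b n1 1 y1 x1"
    using weak_deriv_primitive[OF ab uvw(1) x1i] weak_deriv_cong[of a b y1 F1 x1 x1 n1 1] y1
    by (simp add: F1_def[abs_def])
  have d2: "weak_deriv a b n2 1 y2 G"
    using weak_deriv_primitive[OF ab uvw(2) Gi] weak_deriv_cong[of a b y2 F2 G G n2 1] y2
    by (simp add: F2_def[abs_def])
  have dG: "weak_deriv a b n2 1 G x2"
    using weak_deriv_primitive[OF ab uvw(3) x2i] by (simp add: G_def[abs_def])
  have d22: "weak_deriv a b n2 2 y2 x2"
    using weak_deriv_comp[OF d2, of 1 x2] dG by (simp add: numeral_2_eq_2)
  have S1: "y1 \<in> Sobolev a b 1 n1"
    using y1_L2 L2x(2) d1 weak_deriv_0_refl[of a b n1 y1]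
    by (auto simp: Sobolev_def le_Suc_eq)
  have S2: "y2 \<in> Sobolev a b 2 n2"
    using y2_L2 L2x(3) G_L2 d2 d22 weak_deriv_0_refl[of a b n2 y2]
    by (auto simp: Sobolev_def le_Suc_eq numeral_2_eq_2)
  have AE_I: "AE s in lebesgue_on {a..b}. f s = g s" if "\<And>s. s \<in> {a..b} \<Longrightarrow> f s = g s"
    for f g :: "real \<Rightarrow> real vec"
    using that by (intro AE_I2) simp
  have p1: "point_value a b n1 y1 t = F1 t" if "t \<in> {a..b}" for t
    by (rule point_value_eq[OF ab that F1c F1cont AE_I[OF y1]])
  have p2: "point_value a b n2 y2 t = F2 t" if "t \<in> {a..b}" for t
    by (rule point_value_eq[OF ab that F2c F2cont AE_I[OF y2]])
  \<comment> \<open>\<open>wderiv\<close> of \<open>y2\<close> is only almost everywhere equal to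
    \<open>G\<close>; its point values are nevertheless those of the continuous
    \<open>G\<close>.\<close>
  have p2s: "point_value a b n2 (wderiv a b n2 1 y2) t = G t" if "t \<in> {a..b}" for t
    by (rule point_value_eq[OF ab that Gc Gcont wderiv_AE_eq[OF G_L2 d2]])
  have ends: "F1 a = u" "F2 a = v" "G a = w"
    using uvw by (simp_all only: F1_def F2_def G_def vec_integral_singleton right_zero_vec)
  have "B *\<^sub>v (T_mat a b n1 n2 *\<^sub>v (u @\<^sub>v v @\<^sub>v w) + boundary_source x1 x2) = 0\<^sub>v (n1 + 2 * n2)"
    using core by (subst boundary_condition_iff) (simp_all add: append_carrier_vec_triple uvw)
  then have bc: "B *\<^sub>v (F1 a @\<^sub>v F1 b @\<^sub>v F2 a @\<^sub>v F2 b @\<^sub>v G a @\<^sub>v G b) = 0\<^sub>v (n1 + 2 * n2)"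
    using ab unfolding boundary_values_eq[OF uvw] ends by (simp add: F1_def G_def F2_eq)
  have y0: "block 0 n0 y s = x0 s" if "s \<in> {a..b}" for s
    using y_blocks(1)[OF that] .
  then have y0_L2: "block 0 n0 y \<in> L2 a b n0"
    using L2x(1) L2_cong[of a b "block 0 n0 y" x0] by blast
  have yc: "y s \<in> carrier_vec (n0 + n1 + n2)" if "s \<in> {a..b}" for s
    using y[OF that] x0c[of s] F1c[of s] F2c[of s] by (intro carrier_vecI) (simp add: carrier_vecD)
  show "y \<in> X_space a b n0 n1 n2 B"
    using ab yc y0_L2 S1 S2 bc p1[of a] p1[of b] p2[of a] p2[of b] p2s[of a] p2s[of b]
    by (simp add: X_space_def Let_def flip: y1_def y2_def)
  show "block 0 n0 y s = block 0 n0 xh s" if "s \<in> {a..b}"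
    using y0[OF that] by (simp add: x0_def)
  show "wderiv a b n1 1 (block n0 n1 y) \<in> L2 a b n1"
    using wderiv_spec(1)[OF L2x(2) d1] by (simp add: y1_def)
  show "AE s in lebesgue_on {a..b}. wderiv a b n1 1 (block n0 n1 y) s = block n0 n1 xh s"
    using wderiv_AE_eq[OF L2x(2) d1] by (simp add: y1_def x1_def)
  show "wderiv a b n2 2 (block (n0 + n1) n2 y) \<in> L2 a b n2"
    using wderiv_spec(1)[OF L2x(3) d22] by (simp add: y2_def)
  show "AE s in lebesgue_on {a..b}. wderiv a b n2 2 (block (n0 + n1) n2 y) s = block (n0 + n1) n2 xh s"
    using wderiv_AE_eq[OF L2x(3) d22] by (simp add: y2_def x2_def)
qed

text \<open>The n0 blocks agree at every point of [a,b]; the derivatives agree with the blocks of xh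
  and yh almost everywhere, a difference that the inner product does not see.\<close>

lemma X_inner_T_op:
  assumes x: "xh \<in> L2 a b (n0 + n1 + n2)" and y: "yh \<in> L2 a b (n0 + n1 + n2)"
  shows "X_inner a b n0 n1 n2 (T_op a b n0 n1 n2 B xh) (T_op a b n0 n1 n2 B yh) = L2_inner a b xh yh"
proof -
  let ?Tx = "T_op a b n0 n1 n2 B xh" and ?Ty = "T_op a b n0 n1 n2 B yh"
  have "L2_inner a b (block 0 n0 ?Tx) (block 0 n0 ?Ty) = L2_inner a b (block 0 n0 xh) (block 0 n0 yh)"
    unfolding L2_inner_def using T_op_block_0[OF x] T_op_block_0[OF y]
    by (intro Bochner_Integration.integral_cong) auto
  moreover have "L2_inner a b (wderiv a b n1 1 (block n0 n1 ?Tx)) (wderiv a b n1 1 (block n0 n1 ?Ty))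
      = L2_inner a b (block n0 n1 xh) (block n0 n1 yh)"
    by (rule L2_inner_AE_cong[OF T_op_wderiv_1(1)[OF x] _ T_op_wderiv_1(1)[OF y] _
          T_op_wderiv_1(2)[OF x] T_op_wderiv_1(2)[OF y]])
      (auto intro: block_L2[OF x] block_L2[OF y])
  moreover have "L2_inner a b (wderiv a b n2 2 (block (n0 + n1) n2 ?Tx))
        (wderiv a b n2 2 (block (n0 + n1) n2 ?Ty))
      = L2_inner a b (block (n0 + n1) n2 xh) (block (n0 + n1) n2 yh)"
    by (rule L2_inner_AE_cong[OF T_op_wderiv_2(1)[OF x] _ T_op_wderiv_2(1)[OF y] _
          T_op_wderiv_2(2)[OF x] T_op_wderiv_2(2)[OF y]])
      (auto intro: block_L2[OF x] block_L2[OF y])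
  ultimately show ?thesis
    by (simp add: X_inner_def L2_inner_blocks[OF x y])
qed

end

theorem theorem10:
  fixes a b :: real and n0 n1 n2 :: nat and B :: "real mat"
  assumes "a < b"
    and "B \<in> carrier_mat (n1 + 2 * n2) (2 * n1 + 4 * n2)"
    and "invertible_mat (B * T_mat a b n1 n2)"
  shows "(\<forall>x\<in>X_space a b n0 n1 n2 B.
            L2_eq a b x (T_op a b n0 n1 n2 B (diag_deriv a b n0 n1 n2 x))) \<and>
         (\<forall>xh\<in>L2 a b (n0 + n1 + n2). \<forall>yh\<in>L2 a b (n0 + n1 + n2).
            T_op a b n0 n1 n2 B xh \<in> X_space a b n0 n1 n2 B \<and>
            T_op a b n0 n1 n2 B yh \<in> X_space a b n0 n1 n2 B \<and>
            X_inner a b n0 n1 n2 (T_op a b n0 n1 n2 B xh) (T_op a b n0 n1 n2 B yh)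
              = L2_inner a b xh yh)"
proof -
  interpret boundary_system a b n0 n1 n2 B
    using assms by unfold_locales
  show ?thesis
    using T_op_diag_deriv T_op_in_X_space X_inner_T_op by blast
qed

end
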